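(* Fix $\alpha,\nu\in\mathbb N^h$ and $\beta,\eta\in\mathbb Z^h$. Suppose that, for all sufficiently large $N$, the vectors $N\alpha+\beta$ and $N\nu+\eta$ are nonnegative and have the same total degree (sum of entries). For such $N$ let $w(N)$ be the permutation whose Lehmer code is obtained from $N\alpha+\beta$ by appending enough trailing zeroes to satisfy the Lehmer-code inequalities. Then $$N\longmapsto[\mathbf x^{N\nu+\eta}]\,\mathfrak S_{w(N)}(\mathbf x)$$ is eventually polynomial; that is, there is a polynomial $P$ with which this function agrees for all sufficiently large $N$.
   Context: $\mathbb N=\{0,1,2,\dots\}$; $\mathbf x=(x_1,\dots,x_h)$; $\mathbf x^a=x_1^{a_1}\cdots x_h^{a_h}$; $[\mathbf x^a]f$ is the coefficient of $\mathbf x^a$ in $f$. The Lehmer code of $w\in S_m$ is $\mathrm{code}(w)_i=\#\{j>i: w(j)<w(i)\}$, $1\le i\le m$. If $\gamma\in\mathbb N^h$ and $t$ satisfies the Lehmer-code inequalities $\gamma_i\le h+t-i$ for all $i$, then $(\gamma_1,\dots,\gamma_h,0^t)$ is the Lehmer code of a unique permutation in $S_{h+t}$; increasing $t$ only appends fixed points. Schubert polynomials $\mathfrak S_w$: for the longest element $w_0\in S_m$, $\mathfrak S_{w_0}=x_1^{m-1}x_2^{m-2}\cdots x_{m-1}$, and $\mathfrak S_{ws_i}=\partial_i\mathfrak S_w$ whenever $w(i)>w(i+1)$, where $\partial_i f=(f-s_if)/(x_i-x_{i+1})$ and $s_i$ exchanges $x_i$ and $x_{i+1}$. They do not change when fixed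 points are appended to $w$. If the code of $w$ vanishes after position $h$, then $\mathfrak S_w\in\mathbb Z[x_1,\dots,x_h]$. *)

theory Defs
  imports
    Complex_Main
    "HOL-Library.Poly_Mapping"
    "HOL-Computational_Algebra.Polynomial"
    "HOL-Combinatorics.Permutations"
begin

text \<open>
  Polynomials with integer coefficients in the variables $x_1, x_2, \ldots$: the monoid
  algebra of the finitely supported exponent vectors. The index 0 is not used.
\<close>

type_synonym monomial = "nat \<Rightarrow>\<^sub>0 nat"
type_synonym mpolynomial = "monomial \<Rightarrow>\<^sub>0 int"

definition exponent :: "nat \<Rightarrow> (nat \<Rightarrow> nat) \<Rightarrow> monomial" where
  "exponent h a = (\<Sum>i=1..h. Poly_Mapping.single i (a i))"

definition coeff_at :: "mpolynomial \<Rightarrow> monomial \<Rightarrow> int" where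
  "coeff_at f a = Poly_Mapping.lookup f a"

definition Var :: "nat \<Rightarrow> mpolynomial" where
  "Var i = Poly_Mapping.single (Poly_Mapping.single i 1) 1"

definition adj_transp :: "nat \<Rightarrow> nat \<Rightarrow> nat" where
  "adj_transp i = Transposition.transpose i (i + 1)"

text \<open>
  \<open>Poly_Mapping.map_key g p\<close> is \<open>p \<circ> g\<close> for injective \<open>g\<close>. So the coefficient of
  $x^a$ in the image of $f$ is the coefficient of $x^{a \circ s_i}$ in $f$, which is the
  exchange of $x_i$ and $x_{i+1}$ because $s_i$ is an involution.
\<close>

definition swap_vars :: "nat \<Rightarrow> mpolynomial \<Rightarrow> mpolynomial" where
  "swap_vars i f = Poly_Mapping.map_key (Poly_Mapping.map_key (adj_transp i)) f"

text \<open>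
  The exact quotient $(f - s_i f)/(x_i - x_{i+1})$. It exists since $f - s_i f$ vanishes
  for $x_i = x_{i+1}$, and it is unique since the polynomial ring is an integral domain.
\<close>

definition div_diff :: "nat \<Rightarrow> mpolynomial \<Rightarrow> mpolynomial" where
  "div_diff i f = (THE g. g * (Var i - Var (i + 1)) = f - swap_vars i f)"

text \<open>
  A permutation in $S_m$ is a function \<open>w\<close> with \<open>w permutes {1..m}\<close>.
\<close>

definition lehmer_code :: "nat \<Rightarrow> (nat \<Rightarrow> nat) \<Rightarrow> nat \<Rightarrow> nat" where
  "lehmer_code m w i = card {j \<in> {i<..m}. w j < w i}"

definition longest_perm :: "nat \<Rightarrow> nat \<Rightarrow> nat" where
  "longest_perm m i = (if i \<in> {1..m} then m + 1 - i else i)"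

text \<open>
  The relation is the graph of $w \mapsto \mathfrak{S}_w$ on $S_m$. Every element of $S_m$
  is reached from the longest one by steps that remove a descent, and the result does not
  depend on the chosen steps because the operators \<open>div_diff i\<close> satisfy the braid
  relations.
\<close>

inductive is_schubert :: "nat \<Rightarrow> (nat \<Rightarrow> nat) \<Rightarrow> mpolynomial \<Rightarrow> bool" for m :: nat where
  longest: "is_schubert m (longest_perm m) (\<Prod>i=1..m. Var i ^ (m - i))"
| descent: "is_schubert m w f \<Longrightarrow> i \<in> {1..<m} \<Longrightarrow> w i > w (i + 1) \<Longrightarrow>
    is_schubert m (w \<circ> adj_transp i) (div_diff i f)"

definition schubert :: "nat \<Rightarrow> (nat \<Rightarrow> nat) \<Rightarrow> mpolynomial" where
  "schubert m w = (THE f. is_schubert m w f)"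

definition eventually_polynomial :: "(nat \<Rightarrow> int) \<Rightarrow> bool" where
  "eventually_polynomial f \<longleftrightarrow>
     (\<exists>P :: rat poly. \<forall>\<^sub>F N in sequentially. of_int (f N) = poly P (of_nat N))"

end

theory Submission
  imports Defs
begin

text \<open>
  Sorting the first \<open>h\<close> code entries with the rule
  $(a, b) \mapsto (b + 1, a)$ for $a \le b$ shows that, for large $N$, the polynomial
  $\mathfrak{S}_{w(N)}$ is obtained from a monomial $x^{N\alpha' + \beta'}$ by a word
  $W$ in the $\partial_i$ that does not depend on $N$.

  The coefficients of $W x^{\lambda}$ along an arithmetic progression are treated by
  induction on the number of divided differences in $W$, where $W$ may also contain letters
  $s_i$. Let $\sigma$ be the product of all simple transpositions of $W$. Modulo left
  multiples of words with fewer divided differences, $W x^{\alpha} = x^{\sigma\alpha} W$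
  by the Leibniz rule, and $x_a W = x_b W$ for certain pairs $(a, b)$, one for each
  $\partial_i$ in $W$. If $x^{\sigma\alpha}$ and $x^{\nu}$ become equal under these
  identifications, then the difference in $N$ of the coefficient of $x^{N\nu + \eta}$ in
  $W x^{N\alpha + \beta}$ is a combination of coefficients for smaller words, hence
  eventually polynomial. Otherwise a grading compatible with the identifications makes the
  coefficient vanish for all but at most one $N$.
\<close>

subsection \<open>Divided differences\<close>

abbreviation mon :: "monomial \<Rightarrow> mpolynomial" where
  "mon p \<equiv> frag_of p"

abbreviation swap_mon :: "nat \<Rightarrow> monomial \<Rightarrow> monomial" where
  "swap_mon i \<equiv> Poly_Mapping.map_key (adj_transp i)"

lemma mon_add: "mon (p + q) = mon p * mon q"
  by (simp add: mult_single)

lemma mon_0: "mon 0 = 1"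
  by simp

lemma Var_eq_mon: "Var i = mon (Poly_Mapping.single i 1)"
  by (simp add: Var_def)

text \<open>Integer coefficients arise from monomials by repeated subtraction, so additive
  statements need no case for sums or scalars.\<close>

lemma poly_diff_induct [case_names zero mon diff]:
  assumes "P 0" "\<And>p. P (mon p)" "\<And>f g. P f \<Longrightarrow> P g \<Longrightarrow> P (f - g)"
  shows "P (f :: mpolynomial)"
  by (rule frag_induction [of f UNIV]) (use assms in auto)

text \<open>Induction on the total degree, splitting off one variable at a time.\<close>

lemma monomial_induct [case_names zero add]:
  assumes z: "P 0" and s: "\<And>p i. P p \<Longrightarrow> P (Poly_Mapping.single i 1 + p)"
  shows "P (p :: monomial)"
proof (induction "sum (Poly_Mapping.lookup p) (Poly_Mapping.keys p)" arbitrary: p)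
  case 0
  then have "p = 0"
    by (intro poly_mapping_eqI) (auto simp: in_keys_iff)
  with z show ?case by simp
next
  case (Suc n)
  then obtain i where i: "i \<in> Poly_Mapping.keys p"
    by (metis Zero_not_Suc sum.empty equals0I)
  define q where "q = p - Poly_Mapping.single i 1"
  have p: "p = Poly_Mapping.single i 1 + q"
    using i by (intro poly_mapping_eqI)
      (auto simp: q_def lookup_add lookup_minus lookup_single when_def in_keys_iff)
  have sub: "Poly_Mapping.keys q \<subseteq> Poly_Mapping.keys p"
    by (auto simp: q_def in_keys_iff lookup_minus)
  have "sum (Poly_Mapping.lookup q) (Poly_Mapping.keys q) = sum (Poly_Mapping.lookup q) (Poly_Mapping.keys p)"
    by (rule sum.mono_neutral_left) (use sub in \<open>auto simp: in_keys_iff\<close>)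
  moreover have "sum (Poly_Mapping.lookup p) (Poly_Mapping.keys p) =
     (\<Sum>j\<in>Poly_Mapping.keys p. (if j = i then 1 else 0) + Poly_Mapping.lookup q j)"
    by (subst p) (auto simp: lookup_add lookup_single when_def intro!: sum.cong)
  ultimately have "n = sum (Poly_Mapping.lookup q) (Poly_Mapping.keys q)"
    using i Suc(2) by (simp add: sum.distrib sum.delta)
  then have "P q" by (rule Suc)
  then show ?case unfolding p by (rule s)
qed

lemma adj_transp_involutory [simp]: "adj_transp i (adj_transp i k) = k"
  by (simp add: adj_transp_def)

lemma inj_adj_transp [simp, intro]: "inj (adj_transp i)"
  by (metis adj_transp_involutory injI)

lemma swap_mon_involutory [simp]: "swap_mon i (swap_mon i p) = p"
  by (rule poly_mapping_eqI) (simp add: map_key.rep_eq)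

lemma lookup_swap_mon: "Poly_Mapping.lookup (swap_mon i p) k = Poly_Mapping.lookup p (adj_transp i k)"
  by (simp add: map_key.rep_eq)

lemma inj_swap_mon [simp, intro]: "inj (swap_mon i)"
  by (metis swap_mon_involutory injI)

lemma lookup_swap_vars: "Poly_Mapping.lookup (swap_vars i f) p = Poly_Mapping.lookup f (swap_mon i p)"
  by (simp add: swap_vars_def map_key.rep_eq)

lemma swap_mon_add: "swap_mon i (p + q) = swap_mon i p + swap_mon i q"
  by (simp add: map_key_plus)

lemma swap_mon_0 [simp]: "swap_mon i 0 = 0"
  by simp

lemma swap_mon_single: "swap_mon i (Poly_Mapping.single k c) = Poly_Mapping.single (adj_transp i k) c"
  by (metis adj_transp_involutory inj_adj_transp map_key_single)

lemma swap_vars_mon: "swap_vars i (mon p) = mon (swap_mon i p)"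
  by (metis inj_swap_mon map_key_single swap_mon_involutory swap_vars_def)

lemma swap_vars_0 [simp]: "swap_vars i 0 = 0"
  by (simp add: swap_vars_def)

lemma swap_vars_1 [simp]: "swap_vars i 1 = 1"
  by (metis mon_0 swap_mon_0 swap_vars_mon)

lemma swap_vars_add: "swap_vars i (f + g) = swap_vars i f + swap_vars i g"
  by (rule poly_mapping_eqI) (simp add: lookup_swap_vars lookup_add)

lemma swap_vars_diff: "swap_vars i (f - g) = swap_vars i f - swap_vars i g"
  by (rule poly_mapping_eqI) (simp add: lookup_swap_vars lookup_minus)

lemma swap_vars_mult: "swap_vars i (f * g) = swap_vars i f * swap_vars i g"
proof (induction f rule: poly_diff_induct)
  case (mon p)
  show ?case
    by (induction g rule: poly_diff_induct)
      (simp_all add: swap_vars_mon swap_vars_diff right_diff_distrib swap_mon_add flip: mon_add)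
qed (simp_all add: swap_vars_diff left_diff_distrib)

lemma swap_vars_Var: "swap_vars i (Var k) = Var (adj_transp i k)"
  by (simp add: Var_eq_mon swap_vars_mon swap_mon_single)

lemma swap_vars_involutory [simp]: "swap_vars i (swap_vars i f) = f"
  by (rule poly_mapping_eqI) (simp add: lookup_swap_vars)

lemma adj_transp_simps [simp]:
  "adj_transp i i = Suc i" "adj_transp i (Suc i) = i"
  "k \<noteq> i \<Longrightarrow> k \<noteq> Suc i \<Longrightarrow> adj_transp i k = k"
  by (auto simp: adj_transp_def)

lemma Var_eq_iff [simp]: "Var i = Var j \<longleftrightarrow> i = j"
  by (metis Var_eq_mon frag_of_eq keys_single one_neq_zero singleton_inject)

text \<open>Existence of the quotient. On monomials, one variable is split off by
  \<open>x_k p - s(x_k p) = (x_k - s x_k) p + s(x_k) (p - s p)\<close>, where \<open>s\<close> is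
  the exchange.\<close>

lemma dvd_minus_swap: "(Var i - Var (i + 1)) dvd (f - swap_vars i f)"
proof (induction f rule: poly_diff_induct)
  case (mon p)
  show ?case
  proof (induction p rule: monomial_induct)
    case zero
    then show ?case by (simp add: swap_vars_mon)
  next
    case (add p k)
    have 1: "(Var i - Var (i + 1)) dvd (Var k - swap_vars i (Var k))"
    proof -
      consider "k = i" | "k = Suc i" | "k \<noteq> i \<and> k \<noteq> Suc i" by blast
      then show ?thesis
        by cases (auto simp: swap_vars_Var dvd_def intro: exI [of _ "-1"] exI [of _ 1])
    qed
    have "mon (Poly_Mapping.single k 1 + p) - swap_vars i (mon (Poly_Mapping.single k 1 + p)) =
      (Var k - swap_vars i (Var k)) * mon p + swap_vars i (Var k) * (mon p - swap_vars i (mon p))"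
      unfolding mon_add swap_vars_mult Var_eq_mon by (simp add: algebra_simps)
    then show ?case
      using 1 add by (metis dvd_add dvd_mult dvd_mult2)
  qed
next
  case (diff f g)
  have "f - g - swap_vars i (f - g) = (f - swap_vars i f) - (g - swap_vars i g)"
    by (simp add: swap_vars_diff)
  with diff show ?case by (metis dvd_diff)
qed simp

lemma Var_diff_nonzero: "i \<noteq> j \<Longrightarrow> Var i - Var j \<noteq> 0"
  by simp

text \<open>The factor cancels in an integral domain. Identities for \<open>div_diff\<close> can
  thus be checked after multiplication by \<open>x_i - x_(i+1)\<close>.\<close>

lemma div_diff_unique:
  assumes "g * (Var i - Var (i + 1)) = f - swap_vars i f"
  shows "div_diff i f = g"
  unfolding div_diff_def
proof (rule the_equality, rule assms)
  fix g' assume "g' * (Var i - Var (i + 1)) = f - swap_vars i f"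
  with assms show "g' = g"
    using Var_diff_nonzero [of i "i + 1"] by (metis Suc_eq_plus1 mult_right_cancel n_not_Suc_n)
qed

lemma div_diff_mult: "div_diff i f * (Var i - Var (Suc i)) = f - swap_vars i f"
proof -
  obtain g where "f - swap_vars i f = (Var i - Var (i + 1)) * g"
    using dvd_minus_swap [of i f] by (auto simp: dvd_def)
  then have "g * (Var i - Var (i + 1)) = f - swap_vars i f"
    by (simp add: mult.commute)
  with div_diff_unique [OF this] show ?thesis by simp
qed

lemma div_diff_0 [simp]: "div_diff i 0 = 0"
  by (rule div_diff_unique) simp

lemma div_diff_1 [simp]: "div_diff i 1 = 0"
  by (rule div_diff_unique) simp

lemma div_diff_add: "div_diff i (f + g) = div_diff i f + div_diff i g"
  by (rule div_diff_unique) (simp add: distrib_right div_diff_mult swap_vars_add del: right_diff_distrib)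

lemma div_diff_diff: "div_diff i (f - g) = div_diff i f - div_diff i g"
  by (rule div_diff_unique) (simp add: left_diff_distrib div_diff_mult swap_vars_diff del: right_diff_distrib)

text \<open>Division of \<open>f g - s(f) s(g) = s(f) (g - s g) + (f - s f) g\<close> by
  \<open>x_i - x_(i+1)\<close>.\<close>

lemma div_diff_Leibniz: "div_diff i (f * g) = swap_vars i f * div_diff i g + div_diff i f * g"
proof (rule div_diff_unique)
  have "(swap_vars i f * div_diff i g + div_diff i f * g) * (Var i - Var (i + 1)) =
    swap_vars i f * (div_diff i g * (Var i - Var (Suc i))) + (div_diff i f * (Var i - Var (Suc i))) * g"
    by (simp add: algebra_simps)
  also have "\<dots> = f * g - swap_vars i (f * g)"
    unfolding div_diff_mult swap_vars_mult by (simp add: algebra_simps)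
  finally show "(swap_vars i f * div_diff i g + div_diff i f * g) * (Var i - Var (i + 1)) =
    f * g - swap_vars i (f * g)" .
qed

text \<open>The exchange changes the sign of both numerator and denominator.\<close>

lemma swap_vars_div_diff [simp]: "swap_vars i (div_diff i f) = div_diff i f"
proof -
  have "swap_vars i (div_diff i f) * (Var (Suc i) - Var i) = swap_vars i f - f"
    using arg_cong [OF div_diff_mult [of i f], of "swap_vars i"]
    by (simp add: swap_vars_mult swap_vars_diff swap_vars_Var)
  then have "swap_vars i (div_diff i f) * (Var i - Var (i + 1)) = f - swap_vars i f"
    by (simp add: algebra_simps)
  then show ?thesis by (metis div_diff_unique)
qed

section \<open>Commutation and braid relations\<close>

lemma swap_vars_commute:
  assumes "Suc i < j"
  shows "swap_vars i (swap_vars j f) = swap_vars j (swap_vars i f)"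
proof -
  have "adj_transp i (adj_transp j k) = adj_transp j (adj_transp i k)" for k
    using assms by (auto simp: adj_transp_def Transposition.transpose_def)
  then have "swap_mon i (swap_mon j p) = swap_mon j (swap_mon i p)" for p
    by (intro poly_mapping_eqI) (simp add: lookup_swap_mon)
  then show ?thesis
    by (intro poly_mapping_eqI) (simp add: lookup_swap_vars)
qed

lemma adj_transp_braid:
  "adj_transp i (adj_transp (Suc i) (adj_transp i k)) =
   adj_transp (Suc i) (adj_transp i (adj_transp (Suc i) k))"
  by (auto simp: adj_transp_def Transposition.transpose_def)

lemma swap_vars_braid:
  "swap_vars i (swap_vars (Suc i) (swap_vars i f)) =
   swap_vars (Suc i) (swap_vars i (swap_vars (Suc i) f))"
proof -
  have "swap_mon i (swap_mon (Suc i) (swap_mon i p)) =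
    swap_mon (Suc i) (swap_mon i (swap_mon (Suc i) p))" for p
    by (intro poly_mapping_eqI) (simp add: lookup_swap_mon adj_transp_braid)
  then show ?thesis
    by (intro poly_mapping_eqI) (simp add: lookup_swap_vars)
qed

text \<open>Each denominator is fixed by the other exchange. After multiplication by both, the two
  sides are the same alternating sum of four terms.\<close>

lemma div_diff_commute:
  assumes "Suc i < j"
  shows "div_diff i (div_diff j f) = div_diff j (div_diff i f)"
proof -
  define x where "x = Var i - Var (Suc i)"
  define y where "y = Var j - Var (Suc j)"
  have sx: "swap_vars j x = x" and sy: "swap_vars i y = y"
    using assms by (simp_all add: x_def y_def swap_vars_diff swap_vars_Var)
  have ne: "x * y \<noteq> 0"
    by (simp add: x_def y_def)
  have "div_diff i (div_diff j f) * x * y =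
      div_diff j f * y - swap_vars i (div_diff j f * y)"
    unfolding x_def div_diff_mult by (simp add: swap_vars_mult sy left_diff_distrib)
  also have "\<dots> = f - swap_vars j f - swap_vars i f + swap_vars i (swap_vars j f)"
    unfolding y_def div_diff_mult by (simp add: swap_vars_diff)
  finally have 1: "div_diff i (div_diff j f) * (x * y) =
    f - swap_vars j f - swap_vars i f + swap_vars i (swap_vars j f)"
    by (simp add: mult.assoc)
  have "div_diff j (div_diff i f) * y * x =
      div_diff i f * x - swap_vars j (div_diff i f * x)"
    unfolding y_def div_diff_mult by (simp add: swap_vars_mult sx left_diff_distrib)
  also have "\<dots> = f - swap_vars i f - swap_vars j f + swap_vars j (swap_vars i f)"
    unfolding x_def div_diff_mult by (simp add: swap_vars_diff)
  finally have 2: "div_diff j (div_diff i f) * (x * y) =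
    f - swap_vars j f - swap_vars i f + swap_vars i (swap_vars j f)"
    by (simp add: swap_vars_commute [OF assms] algebra_simps)
  from 1 2 ne show ?thesis by (metis mult_right_cancel)
qed

text \<open>
  Both sides of the braid relation are the antisymmetrisation of \<open>f\<close> over the
  permutations of three variables, divided by their Vandermonde product.
\<close>

lemma div_diff_braid:
  "div_diff i (div_diff (Suc i) (div_diff i f)) =
   div_diff (Suc i) (div_diff i (div_diff (Suc i) f))"
proof -
  define s where "s = swap_vars i"
  define r where "r = swap_vars (Suc i)"
  define x where "x = Var i"
  define y where "y = Var (Suc i)"
  define z where "z = Var (Suc (Suc i))"
  have S: "s (g - k) = s g - s k" "s (g * k) = s g * s k" "r (g - k) = r g - r k" "r (g * k) = r g * r k"
    for g k by (simp_all add: s_def r_def swap_vars_diff swap_vars_mult)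
  have V: "s x = y" "s y = x" "s z = z" "r x = x" "r y = z" "r z = y"
    by (simp_all add: s_def r_def x_def y_def z_def swap_vars_Var)
  have ne: "(x - y) * (x - z) * (y - z) \<noteq> 0"
    by (simp add: x_def y_def z_def)
  have D: "div_diff i g * (x - y) = g - s g" "div_diff (Suc i) g * (y - z) = g - r g" for g
    using div_diff_mult [of i g] div_diff_mult [of "Suc i" g] by (simp_all add: s_def r_def x_def y_def z_def)
  have I: "s (div_diff i g) = div_diff i g" "r (div_diff (Suc i) g) = div_diff (Suc i) g" for g
    by (simp_all add: s_def r_def)
  define A where "A = div_diff i f"
  define B where "B = div_diff (Suc i) A"
  define A' where "A' = div_diff (Suc i) f"
  define B' where "B' = div_diff i A'"
  have A: "A * (x - y) = f - s f" "s A = A"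
    unfolding A_def by (simp_all add: D I)
  have A': "A' * (y - z) = f - r f" "r A' = A'"
    unfolding A'_def by (simp_all add: D I)
  have B: "B * (y - z) = A - r A" unfolding B_def by (simp add: D)
  have B': "B' * (x - y) = A' - s A'" unfolding B'_def by (simp add: D)
  \<comment> \<open>Transporting the defining identities by \<open>s\<close> and \<open>r\<close>
    turns every denominator into one of the three differences of \<open>x\<close>, \<open>y\<close>,
    \<open>z\<close>, so clearing the Vandermonde product needs no further division.\<close>
  have rA: "r A * (x - z) = r f - r (s f)"
    using arg_cong [OF A(1), of r] by (simp add: S V)
  have srA: "s (r A) * (y - z) = s (r f) - s (r (s f))"
    using arg_cong [OF rA, of s] by (simp add: S V)
  have sB: "s B * (x - z) = A - s (r A)"
    using arg_cong [OF B, of s] A(2) by (simp add: S V)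
  have sA': "s A' * (x - z) = s f - s (r f)"
    using arg_cong [OF A'(1), of s] by (simp add: S V)
  have rsA': "r (s A') * (x - y) = r (s f) - r (s (r f))"
    using arg_cong [OF sA', of r] by (simp add: S V)
  have rB': "r B' * (x - z) = A' - r (s A')"
    using arg_cong [OF B', of r] A'(2) by (simp add: S V)
  have "div_diff i B * ((x - y) * (x - z) * (y - z)) = (div_diff i B * (x - y)) * (x - z) * (y - z)"
    by (simp only: mult_ac)
  also have "\<dots> = (B * (y - z)) * (x - z) - (s B * (x - z)) * (y - z)"
    unfolding D by (simp add: algebra_simps)
  also have "\<dots> = A * (x - y) - r A * (x - z) + s (r A) * (y - z)"
    unfolding B sB by (simp add: algebra_simps)
  also have "\<dots> = f - s f - r f + r (s f) + s (r f) - s (r (s f))"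
    unfolding A rA srA by simp
  finally have 1: "div_diff i B * ((x - y) * (x - z) * (y - z)) = \<dots>" .
  have "div_diff (Suc i) B' * ((x - y) * (x - z) * (y - z)) = (div_diff (Suc i) B' * (y - z)) * (x - z) * (x - y)"
    by (simp only: mult_ac)
  also have "\<dots> = (B' * (x - y)) * (x - z) - (r B' * (x - z)) * (x - y)"
    unfolding D by (simp add: algebra_simps)
  also have "\<dots> = A' * (y - z) - s A' * (x - z) + r (s A') * (x - y)"
    unfolding B' rB' by (simp add: algebra_simps)
  also have "\<dots> = f - r f - s f + s (r f) + r (s f) - r (s (r f))"
    unfolding A' sA' rsA' by simp
  also have "\<dots> = f - s f - r f + r (s f) + s (r f) - s (r (s f))"
    using swap_vars_braid [of i f] by (simp add: s_def r_def)
  finally have "div_diff i B = div_diff (Suc i) B'"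
    using 1 ne by (metis mult_right_cancel)
  then show ?thesis by (simp add: A_def B_def A'_def B'_def)
qed

subsection \<open>Eventually polynomial functions\<close>

lemma eventually_polynomial_0: "eventually_polynomial (\<lambda>N. 0)"
  unfolding eventually_polynomial_def by (rule exI [of _ 0]) simp

lemma eventually_polynomial_diff:
  assumes "eventually_polynomial f" "eventually_polynomial g"
  shows "eventually_polynomial (\<lambda>N. f N - g N)"
proof -
  obtain P Q where "\<forall>\<^sub>F N in sequentially. rat_of_int (f N) = poly P (of_nat N)"
    "\<forall>\<^sub>F N in sequentially. rat_of_int (g N) = poly Q (of_nat N)"
    using assms unfolding eventually_polynomial_def by auto
  then have "\<forall>\<^sub>F N in sequentially. rat_of_int (f N - g N) = poly (P - Q) (of_nat N)"
    by eventually_elim simp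
  then show ?thesis unfolding eventually_polynomial_def by blast
qed

lemma eventually_polynomial_cong:
  assumes "\<forall>\<^sub>F N in sequentially. f N = g N" "eventually_polynomial f"
  shows "eventually_polynomial g"
proof -
  obtain P where "\<forall>\<^sub>F N in sequentially. rat_of_int (f N) = poly P (of_nat N)"
    using assms(2) unfolding eventually_polynomial_def by auto
  with assms(1) have "\<forall>\<^sub>F N in sequentially. rat_of_int (g N) = poly P (of_nat N)"
    by eventually_elim simp
  then show ?thesis unfolding eventually_polynomial_def by blast
qed

text \<open>Substitution of \<open>x - k\<close>. This lets arguments start at a threshold from
  which the data are well behaved.\<close>

lemma eventually_polynomial_shift:
  assumes "eventually_polynomial (\<lambda>N. f (N + k))"
  shows "eventually_polynomial f"
proof -
  obtain P where P: "\<forall>\<^sub>F N in sequentially. rat_of_int (f (N + k)) = poly P (of_nat N)"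
    using assms unfolding eventually_polynomial_def by auto
  define Q where "Q = pcompose P [:- of_nat k, 1:]"
  have "\<forall>\<^sub>F N in sequentially. rat_of_int (f (N + k)) = poly Q (of_nat (N + k))"
    using P by eventually_elim (simp add: Q_def poly_pcompose)
  then have "\<forall>\<^sub>F N in sequentially. rat_of_int (f N) = poly Q (of_nat N)"
    by (rule eventually_sequentially_seg [THEN iffD1])
  then show ?thesis unfolding eventually_polynomial_def by blast
qed

text \<open>The difference of \<open>x ^ Suc k\<close> is \<open>Suc k * x ^ k\<close> plus lower
  powers. The antidifferences of the latter, given by induction, are subtracted.\<close>

lemma poly_antidifference_power:
  "\<exists>P :: 'a :: field_char_0 poly. \<forall>x. poly P (x + 1) - poly P x = x ^ k"
proof (induction k rule: less_induct)
  case (less k)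
  then obtain A :: "nat \<Rightarrow> 'a poly" where
    A: "\<And>j x. j < k \<Longrightarrow> poly (A j) (x + 1) - poly (A j) x = x ^ j"
    by metis
  define P where "P = smult (1 / of_nat (Suc k))
    (monom 1 (Suc k) - (\<Sum>j<k. smult (of_nat (Suc k choose j)) (A j)))"
  have "poly P (x + 1) - poly P x = x ^ k" for x
  proof -
    have "(x + 1) ^ Suc k = (\<Sum>j<Suc (Suc k). of_nat (Suc k choose j) * x ^ j)"
      unfolding binomial_ring by (simp flip: lessThan_Suc_atMost)
    also have "\<dots> = (\<Sum>j<k. of_nat (Suc k choose j) * x ^ j) + of_nat (Suc k) * x ^ k + x ^ Suc k"
      by simp
    finally have b: "(x + 1) ^ Suc k - x ^ Suc k - (\<Sum>j<k. of_nat (Suc k choose j) * x ^ j) =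
      of_nat (Suc k) * x ^ k"
      by simp
    have "of_nat (Suc k) * (poly P (x + 1) - poly P x) =
        ((x + 1) ^ Suc k - (\<Sum>j<k. of_nat (Suc k choose j) * poly (A j) (x + 1)))
      - (x ^ Suc k - (\<Sum>j<k. of_nat (Suc k choose j) * poly (A j) x))"
      unfolding P_def poly_smult poly_diff poly_monom poly_sum
      by (simp add: field_simps del: of_nat_Suc power_Suc)
    also have "\<dots> = (x + 1) ^ Suc k - x ^ Suc k
      - (\<Sum>j<k. of_nat (Suc k choose j) * (poly (A j) (x + 1) - poly (A j) x))"
      by (simp add: right_diff_distrib sum_subtractf del: power_Suc)
    also have "\<dots> = of_nat (Suc k) * x ^ k"
      using b by (simp add: A del: of_nat_Suc power_Suc)
    finally show ?thesis
      by (metis mult_left_cancel of_nat_neq_0)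
  qed
  then show ?case by blast
qed

lemma poly_antidifference:
  "\<exists>P :: 'a :: field_char_0 poly. \<forall>x. poly P (x + 1) - poly P x = poly Q x"
proof -
  obtain A :: "nat \<Rightarrow> 'a poly" where A: "\<And>j x. poly (A j) (x + 1) - poly (A j) x = x ^ j"
    using poly_antidifference_power by metis
  have "poly (\<Sum>j\<le>degree Q. smult (coeff Q j) (A j)) (x + 1) -
    poly (\<Sum>j\<le>degree Q. smult (coeff Q j) (A j)) x = poly Q x" for x
    by (simp add: poly_sum poly_altdef [of Q] A flip: sum_subtractf right_diff_distrib)
  then show ?thesis by blast
qed

lemma eventually_polynomial_antidifference:
  assumes "eventually_polynomial (\<lambda>N. f (Suc N) - f N)"
  shows "eventually_polynomial f"
proof -
  obtain Q where "\<forall>\<^sub>F N in sequentially. rat_of_int (f (Suc N) - f N) = poly Q (of_nat N)"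
    using assms unfolding eventually_polynomial_def by auto
  then obtain k where k: "\<And>N. N \<ge> k \<Longrightarrow> rat_of_int (f (Suc N) - f N) = poly Q (of_nat N)"
    unfolding eventually_sequentially by auto
  obtain P where P: "\<And>x. poly P (x + 1) - poly P x = poly Q x"
    using poly_antidifference [of Q] by blast
  \<comment> \<open>The constant makes \<open>R\<close> agree with \<open>f\<close> at
    \<open>k\<close>; equal differences carry the agreement upwards.\<close>
  define R where "R = P + [:of_int (f k) - poly P (of_nat k):]"
  have "rat_of_int (f N) = poly R (of_nat N)" if "N \<ge> k" for N
    using that
  proof (induction N rule: dec_induct)
    case base
    then show ?case by (simp add: R_def)
  next
    case (step n)
    then show ?case
      using k [of n] P [of "of_nat n"] by (simp add: R_def algebra_simps)
  qed
  then show ?thesis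
    unfolding eventually_polynomial_def eventually_sequentially by blast
qed

subsection \<open>Words in exchanges and divided differences\<close>

text \<open>Exchanges are letters in their own right because lowering the number of divided
  differences turns \<open>Diff i\<close> into \<open>Swap i\<close>.\<close>

datatype letter = Swap nat | Diff nat

primrec letter_index :: "letter \<Rightarrow> nat" where
  "letter_index (Swap i) = i"
| "letter_index (Diff i) = i"

primrec act_letter :: "letter \<Rightarrow> mpolynomial \<Rightarrow> mpolynomial" where
  "act_letter (Swap i) = swap_vars i"
| "act_letter (Diff i) = div_diff i"

definition act :: "letter list \<Rightarrow> mpolynomial \<Rightarrow> mpolynomial" where
  "act W = foldr act_letter W"

text \<open>The action of the permutation \<sigma> of the overview: a \<open>Diff\<close> letter
  counts as its exchange, as in the leading term of the Leibniz rule.\<close>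

definition perm_vars :: "letter list \<Rightarrow> mpolynomial \<Rightarrow> mpolynomial" where
  "perm_vars W = foldr (\<lambda>x. swap_vars (letter_index x)) W"

definition perm_mon :: "letter list \<Rightarrow> monomial \<Rightarrow> monomial" where
  "perm_mon W = foldr (\<lambda>x. swap_mon (letter_index x)) W"

primrec num_diffs :: "letter list \<Rightarrow> nat" where
  "num_diffs [] = 0"
| "num_diffs (x # W) = (case x of Swap i \<Rightarrow> 0 | Diff i \<Rightarrow> 1) + num_diffs W"

text \<open>For \<open>W = U @ Diff i # V\<close>, the pair contributed by this letter is the image
  of \<open>(i, Suc i)\<close> under the exchanges of all letters of \<open>U\<close>,
  \<open>Diff\<close> letters included.\<close>

primrec roots :: "letter list \<Rightarrow> (nat \<times> nat) set" where
  "roots [] = {}"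
| "roots (x # W) = (case x of Swap i \<Rightarrow> {} | Diff i \<Rightarrow> {(i, Suc i)}) \<union>
     map_prod (adj_transp (letter_index x)) (adj_transp (letter_index x)) ` roots W"

lemma act_simps [simp]: "act [] f = f" "act (x # W) f = act_letter x (act W f)"
  by (simp_all add: act_def)

lemma perm_vars_simps [simp]: "perm_vars [] f = f"
    "perm_vars (x # W) f = swap_vars (letter_index x) (perm_vars W f)"
  by (simp_all add: perm_vars_def)

lemma perm_mon_simps [simp]: "perm_mon [] p = p"
    "perm_mon (x # W) p = swap_mon (letter_index x) (perm_mon W p)"
  by (simp_all add: perm_mon_def)

lemma perm_vars_mon: "perm_vars W (mon p) = mon (perm_mon W p)"
  by (induction W) (simp_all add: swap_vars_mon)

lemma perm_mon_add: "perm_mon W (p + q) = perm_mon W p + perm_mon W q"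
  by (induction W) (simp_all add: swap_mon_add)

text \<open>The left module over the polynomial ring generated by the words with fewer than
  \<open>d\<close> divided differences. For \<open>d = 0\<close> only the zero operator
  remains.\<close>

inductive_set operators :: "nat \<Rightarrow> (mpolynomial \<Rightarrow> mpolynomial) set" for d :: nat where
  zero: "(\<lambda>f. 0) \<in> operators d"
| act: "num_diffs W < d \<Longrightarrow> act W \<in> operators d"
| diff: "S \<in> operators d \<Longrightarrow> T \<in> operators d \<Longrightarrow> (\<lambda>f. S f - T f) \<in> operators d"
| mult_mon: "T \<in> operators d \<Longrightarrow> (\<lambda>f. mon p * T f) \<in> operators d"

lemma operators_add:
  assumes "S \<in> operators d" "T \<in> operators d"
  shows "(\<lambda>f. S f + T f) \<in> operators d"
  using operators.diff [OF assms(1) operators.diff [OF operators.zero assms(2)]] by simp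

lemma operators_mult:
  assumes "T \<in> operators d"
  shows "(\<lambda>f. g * T f) \<in> operators d"
proof (induction g rule: poly_diff_induct)
  case (diff g k)
  then show ?case
    using operators.diff [of "\<lambda>f. g * T f" d "\<lambda>f. k * T f"] by (simp add: left_diff_distrib)
qed (simp_all add: operators.zero operators.mult_mon assms)

lemma operators_mono:
  assumes "T \<in> operators d" "d \<le> d'"
  shows "T \<in> operators d'"
  using assms(1)
  by induction (use assms(2) in \<open>auto intro: operators.intros order.strict_trans2\<close>)

lemma operators_swap_vars:
  assumes "T \<in> operators d"
  shows "(\<lambda>f. swap_vars i (T f)) \<in> operators d"
  using assms
proof induction
  case (act W)
  then show ?case using operators.act [of "Swap i # W" d] by (simp add: act_def comp_def)
next
  case (diff S T)
  then show ?case by (simp add: swap_vars_diff operators.diff)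
next
  case (mult_mon T p)
  then show ?case by (simp add: swap_vars_mult operators_mult)
qed (simp add: operators.zero)

text \<open>For a multiple \<open>p T\<close> the Leibniz rule also produces a term in
  \<open>T\<close> itself, which lies in the smaller module and is absorbed by
  \<open>operators_mono\<close>.\<close>

lemma operators_div_diff:
  assumes "T \<in> operators d"
  shows "(\<lambda>f. div_diff i (T f)) \<in> operators (Suc d)"
  using assms
proof induction
  case (act W)
  then show ?case using operators.act [of "Diff i # W" "Suc d"] by (simp add: act_def comp_def)
next
  case (diff S T)
  then show ?case by (simp add: div_diff_diff operators.diff)
next
  case (mult_mon T p)
  have "T \<in> operators (Suc d)"
    using mult_mon.hyps by (rule operators_mono) simp
  with mult_mon.IH show ?case by (simp add: div_diff_Leibniz operators_add operators_mult)
qed (simp add: operators.zero)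

text \<open>Moving \<open>g\<close> to the left through a \<open>Diff\<close> letter leaves its
  exchange in front of the full word. The other Leibniz term has lost that divided difference and
  goes into the remainder.\<close>

lemma act_mult_operators:
  "(\<lambda>f. act W (g * f) - perm_vars W g * act W f) \<in> operators (num_diffs W)"
proof (induction W)
  case Nil
  then show ?case by (simp add: operators.zero)
next
  case (Cons x W)
  define T where "T = (\<lambda>f. act W (g * f) - perm_vars W g * act W f)"
  have T: "T \<in> operators (num_diffs W)"
    using Cons by (simp add: T_def)
  have eq: "act W (g * f) = T f + perm_vars W g * act W f" for f
    by (simp add: T_def)
  show ?case
  proof (cases x)
    case (Swap i)
    then show ?thesis
      using operators_swap_vars [OF T, of i] by (simp add: eq swap_vars_add swap_vars_mult)
  next
    case (Diff i)
    have "act W \<in> operators (Suc (num_diffs W))"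
      by (rule operators.act) simp
    then have "(\<lambda>f. div_diff i (T f) + div_diff i (perm_vars W g) * act W f) \<in> operators (Suc (num_diffs W))"
      by (intro operators_add operators_mult operators_div_diff T)
    then show ?thesis
      using Diff by (simp add: eq div_diff_add div_diff_Leibniz)
  qed
qed

text \<open>
  From \<open>(x\<^sub>i - x\<^sub>i\<^sub>+\<^sub>1) \<partial>\<^sub>i = 1 - s\<^sub>i\<close>, moved to the left through the
  preceding letters.
\<close>

lemma root_mult_operators:
  assumes "(a, b) \<in> roots W"
  shows "(\<lambda>f. (Var a - Var b) * act W f) \<in> operators (num_diffs W)"
  using assms
proof (induction W arbitrary: a b)
  case (Cons x W)
  show ?case
  proof (cases "x = Diff a \<and> b = Suc a")
    case True
    have "(\<lambda>f. act W f - act (Swap a # W) f) \<in> operators (num_diffs (x # W))"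
      by (intro operators.diff operators.act) (use True in simp_all)
    then show ?thesis
      using True div_diff_mult [of a] by (simp add: mult.commute)
  next
    case False
    define i where "i = letter_index x"
    from False Cons.prems obtain a' b' where ab: "a = adj_transp i a'" "b = adj_transp i b'"
      "(a', b') \<in> roots W"
      by (cases x) (auto simp: i_def)
    define T where "T = (\<lambda>f. (Var a' - Var b') * act W f)"
    have T: "T \<in> operators (num_diffs W)"
      using Cons.IH ab(3) by (simp add: T_def)
    show ?thesis
    proof (cases x)
      case (Swap j)
      then show ?thesis
        using operators_swap_vars [OF T, of i] ab
        by (simp add: T_def swap_vars_mult swap_vars_diff swap_vars_Var i_def)
    next
      case (Diff j)
      \<comment> \<open>With \<open>g = Var a' - Var b'\<close>, the Leibniz rule reads
        \<open>s_i(g) \<partial>_i F = \<partial>_i (g F) - \<partial>_i(g) F\<close>. On the right,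
        the first term is covered by the induction hypothesis and the second lacks the new divided
        difference.\<close>
      have "act W \<in> operators (Suc (num_diffs W))"
        by (rule operators.act) simp
      then have "(\<lambda>f. div_diff i (T f) - div_diff i (Var a' - Var b') * act W f) \<in> operators (Suc (num_diffs W))"
        by (intro operators.diff operators_mult operators_div_diff T)
      then show ?thesis
        using Diff ab by (simp add: T_def div_diff_Leibniz swap_vars_diff swap_vars_Var i_def)
    qed
  qed
qed simp

section \<open>Gradings by the degree in a set of variables\<close>

definition weight :: "nat set \<Rightarrow> monomial \<Rightarrow> nat" where
  "weight C p = (\<Sum>i\<in>Poly_Mapping.keys p. if i \<in> C then Poly_Mapping.lookup p i else 0)"

lemma weight_0 [simp]: "weight C 0 = 0"
  by (simp add: weight_def)

lemma weight_add: "weight C (p + q) = weight C p + weight C q"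
  unfolding weight_def
  using setsum_keys_plus_distrib [where f = "\<lambda>k v. if k \<in> C then v else 0" and p = p and q = q]
  by simp

lemma weight_single [simp]: "weight C (Poly_Mapping.single i k) = (if i \<in> C then k else 0)"
  by (cases "k = 0") (simp_all add: weight_def)

lemma weight_swap_mon: "weight C (swap_mon i p) = weight (adj_transp i -` C) p"
  by (induction p rule: monomial_induct) (simp_all add: weight_add swap_mon_add swap_mon_single)

text \<open>The degree is an integer since a divided difference may formally lower it below 0, where
  only the zero polynomial is homogeneous.\<close>

definition homogeneous :: "nat set \<Rightarrow> int \<Rightarrow> mpolynomial \<Rightarrow> bool" where
  "homogeneous C k f \<longleftrightarrow> (\<forall>p\<in>Poly_Mapping.keys f. int (weight C p) = k)"

lemma homogeneous_0 [simp]: "homogeneous C k 0"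
  by (simp add: homogeneous_def)

lemma homogeneous_mon [simp]: "homogeneous C k (mon p) \<longleftrightarrow> int (weight C p) = k"
  by (simp add: homogeneous_def keys_frag_of)

lemma homogeneous_diff: "homogeneous C k f \<Longrightarrow> homogeneous C k g \<Longrightarrow> homogeneous C k (f - g)"
  unfolding homogeneous_def using keys_diff [of f g] by blast

lemma homogeneous_add: "homogeneous C k f \<Longrightarrow> homogeneous C k g \<Longrightarrow> homogeneous C k (f + g)"
  unfolding homogeneous_def using keys_add [of f g] by blast

lemma homogeneous_mult: "homogeneous C k f \<Longrightarrow> homogeneous C l g \<Longrightarrow> homogeneous C (k + l) (f * g)"
  unfolding homogeneous_def using keys_mult [of f g] by (fastforce simp: weight_add)

lemma homogeneous_swap_vars:
  assumes "homogeneous (adj_transp i -` C) k f"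
  shows "homogeneous C k (swap_vars i f)"
  unfolding homogeneous_def
proof
  fix p assume "p \<in> Poly_Mapping.keys (swap_vars i f)"
  then have "swap_mon i p \<in> Poly_Mapping.keys f"
    by (simp add: in_keys_iff lookup_swap_vars)
  then have "int (weight (adj_transp i -` C) (swap_mon i p)) = k"
    using assms by (simp add: homogeneous_def)
  moreover have "adj_transp i -` adj_transp i -` C = C"
    by auto
  ultimately show "int (weight C p) = k"
    by (simp add: weight_swap_mon)
qed

lemma vimage_adj_transp:
  assumes "i \<in> C \<longleftrightarrow> Suc i \<in> C"
  shows "adj_transp i -` C = C"
proof -
  have "adj_transp i k \<in> C \<longleftrightarrow> k \<in> C" for k
    using assms by (cases "k = i \<or> k = Suc i") auto
  then show ?thesis by auto
qed

text \<open>When \<open>x_i\<close> and \<open>x_(i+1)\<close> have the same weight, their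
  difference is homogeneous and so is the quotient by it. The proof splits off variables by the
  Leibniz rule.\<close>

lemma homogeneous_div_diff_mon:
  assumes "i \<in> C \<longleftrightarrow> Suc i \<in> C"
  shows "homogeneous C (int (weight C p) - of_bool (i \<in> C)) (div_diff i (mon p))"
proof (induction p rule: monomial_induct)
  case (add p k)
  let ?k = "int (weight C (Poly_Mapping.single k 1 + p)) - of_bool (i \<in> C)"
  have "weight C (swap_mon i (Poly_Mapping.single k 1)) = weight C (Poly_Mapping.single k 1)"
    unfolding weight_swap_mon vimage_adj_transp [OF assms] ..
  then have "homogeneous C (int (weight C (Poly_Mapping.single k 1))) (swap_vars i (Var k))"
    by (simp only: Var_eq_mon swap_vars_mon homogeneous_mon)
  from homogeneous_mult [OF this add]
  have "homogeneous C ?k (swap_vars i (Var k) * div_diff i (mon p))"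
    by (simp add: weight_add algebra_simps)
  moreover have "homogeneous C ?k (div_diff i (Var k) * mon p)"
  proof -
    consider "k = i" | "k = Suc i" | "k \<noteq> i" "k \<noteq> Suc i" by blast
    then show ?thesis
    proof cases
      case 1
      then have "div_diff i (Var k) = 1"
        by (intro div_diff_unique) (simp add: swap_vars_Var)
      then show ?thesis using 1 by (simp add: weight_add)
    next
      case 2
      then have "div_diff i (Var k) = 0 - 1"
        by (intro div_diff_unique) (simp add: swap_vars_Var)
      then have eq: "div_diff i (Var k) * mon p = 0 - mon p" by simp
      have "?k = int (weight C p)"
        using 2 assms by (simp add: weight_add)
      then show ?thesis
        unfolding eq by (intro homogeneous_diff) simp_all
    next
      case 3
      then have "div_diff i (Var k) = 0"
        by (intro div_diff_unique) (simp add: swap_vars_Var)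
      then show ?thesis by simp
    qed
  qed
  ultimately show ?case
    unfolding mon_add Var_eq_mon [symmetric] div_diff_Leibniz by (rule homogeneous_add)
qed simp

lemma homogeneous_div_diff:
  assumes "i \<in> C \<longleftrightarrow> Suc i \<in> C" "homogeneous C k f"
  shows "homogeneous C (k - of_bool (i \<in> C)) (div_diff i f)"
proof -
  have "Poly_Mapping.keys f \<subseteq> {p. int (weight C p) = k}"
    using assms(2) by (auto simp: homogeneous_def)
  then show ?thesis
  proof (induction f rule: frag_induction)
    case (one p)
    then show ?case using homogeneous_div_diff_mon [OF assms(1), of p] by simp
  qed (simp_all add: div_diff_diff homogeneous_diff)
qed

text \<open>If no root is separated by \<open>C\<close>, every divided difference in
  \<open>W\<close> respects the grading transported to its place. The shift \<open>c\<close> does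
  not depend on the monomial.\<close>

lemma homogeneous_act:
  assumes "\<And>a b. (a, b) \<in> roots W \<Longrightarrow> a \<in> C \<longleftrightarrow> b \<in> C"
  shows "\<exists>c. \<forall>p. homogeneous C (int (weight C (perm_mon W p)) + c) (act W (mon p))"
  using assms
proof (induction W arbitrary: C)
  case Nil
  show ?case by (rule exI [of _ 0]) simp
next
  case (Cons x W)
  define i where "i = letter_index x"
  \<comment> \<open>The first letter pulls the grading back along its exchange. The roots of the
    remaining word are carried by that exchange to roots of \<open>x # W\<close>, so the hypothesis
    passes to \<open>C'\<close>.\<close>
  define C' where "C' = adj_transp i -` C"
  have "a \<in> C' \<longleftrightarrow> b \<in> C'" if "(a, b) \<in> roots W" for a b
    using Cons.prems [of "adj_transp i a" "adj_transp i b"] that by (force simp: i_def C'_def)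
  then obtain c where c: "\<And>p. homogeneous C' (int (weight C' (perm_mon W p)) + c) (act W (mon p))"
    using Cons.IH by metis
  show ?case
  proof (cases x)
    case (Swap j)
    then show ?thesis
      using homogeneous_swap_vars [OF c [unfolded C'_def]]
      by (auto simp: i_def C'_def weight_swap_mon)
  next
    case (Diff j)
    then have C: "i \<in> C \<longleftrightarrow> Suc i \<in> C"
      using Cons.prems [of i "Suc i"] by (simp add: i_def)
    then have C': "C' = C"
      unfolding C'_def by (rule vimage_adj_transp)
    show ?thesis
    proof (intro exI allI)
      fix p
      show "homogeneous C (int (weight C (perm_mon (x # W) p)) + (c - of_bool (i \<in> C))) (act (x # W) (mon p))"
        using homogeneous_div_diff [OF C c [unfolded C', of p]] Diff vimage_adj_transp [OF C]
        by (simp add: i_def weight_swap_mon algebra_simps)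
    qed
  qed
qed

section \<open>The ideal killing a word modulo words with fewer divided differences\<close>

definition annihilates :: "letter list \<Rightarrow> mpolynomial \<Rightarrow> bool" where
  "annihilates W g \<longleftrightarrow> (\<lambda>f. g * act W f) \<in> operators (num_diffs W)"

lemma annihilates_0: "annihilates W 0"
  by (simp add: annihilates_def operators.zero)

lemma annihilates_add: "annihilates W g \<Longrightarrow> annihilates W k \<Longrightarrow> annihilates W (g + k)"
  unfolding annihilates_def by (drule (1) operators_add) (simp add: distrib_right)

lemma annihilates_mult: "annihilates W g \<Longrightarrow> annihilates W (k * g)"
  unfolding annihilates_def by (drule operators_mult [of _ _ k]) (simp add: mult.assoc)

text \<open>Congruence of variables modulo the ideal. Compared with an equivalence closure of
  \<open>roots W\<close>, this makes the laws of an equivalence immediate from the ideal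
  properties.\<close>

definition linked :: "letter list \<Rightarrow> nat \<Rightarrow> nat set" where
  "linked W i = {j. annihilates W (Var i - Var j)}"

lemma linked_refl: "i \<in> linked W i"
  by (simp add: linked_def annihilates_0)

lemma linked_sym:
  assumes "j \<in> linked W i" shows "i \<in> linked W j"
  using annihilates_mult [of W "Var i - Var j" "- 1"] assms by (simp add: linked_def)

lemma linked_trans:
  assumes "j \<in> linked W i" "k \<in> linked W j" shows "k \<in> linked W i"
  using annihilates_add [of W "Var i - Var j" "Var j - Var k"] assms by (simp add: linked_def)

text \<open>This makes every class of linked variables an admissible grading for
  \<open>homogeneous_act\<close>.\<close>

lemma linked_roots: "(a, b) \<in> roots W \<Longrightarrow> a \<in> linked W i \<longleftrightarrow> b \<in> linked W i"
proof -
  assume "(a, b) \<in> roots W"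
  then have "b \<in> linked W a"
    using root_mult_operators by (simp add: linked_def annihilates_def)
  then show ?thesis
    using linked_sym linked_trans by blast
qed

lemma weight_pos_keys: "weight C p \<noteq> 0 \<Longrightarrow> \<exists>i\<in>C. i \<in> Poly_Mapping.keys p"
  by (auto simp: weight_def split: if_splits)

text \<open>Monomials with the same degree in each class are congruent modulo the ideal. A factor
  \<open>x_i\<close> is matched with a factor \<open>x_j\<close> of \<open>q\<close> from its class,
  using \<open>x_i p - x_j r = p (x_i - x_j) + x_j (p - r)\<close>.\<close>

lemma annihilates_mon_diff:
  assumes "\<And>i. weight (linked W i) p = weight (linked W i) q"
  shows "annihilates W (mon p - mon q)"
  using assms
proof (induction p arbitrary: q rule: monomial_induct)
  case zero
  have "Poly_Mapping.keys q = {}"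
  proof (rule ccontr)
    assume "Poly_Mapping.keys q \<noteq> {}"
    then obtain i where "i \<in> Poly_Mapping.keys q" by blast
    then have "weight (linked W i) q \<noteq> 0"
      using linked_refl [of i W] by (auto simp: weight_def in_keys_iff)
    then show False using zero [of i] by simp
  qed
  then show ?case by (simp add: annihilates_0)
next
  case (add p i)
  have "weight (linked W i) q \<noteq> 0"
    using add.prems [of i] linked_refl [of i W] by (simp add: weight_add)
  then obtain j where j: "j \<in> linked W i" "j \<in> Poly_Mapping.keys q"
    using weight_pos_keys by blast
  define r where "r = q - Poly_Mapping.single j 1"
  have q: "q = Poly_Mapping.single j 1 + r"
    using j(2) by (intro poly_mapping_eqI)
      (auto simp: r_def lookup_add lookup_minus lookup_single when_def in_keys_iff)
  have "weight (linked W k) p = weight (linked W k) r" for k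
  proof -
    have "i \<in> linked W k \<longleftrightarrow> j \<in> linked W k"
      using j(1) linked_sym linked_trans by blast
    then show ?thesis using add.prems [of k] by (simp add: q weight_add split: if_splits)
  qed
  then have "annihilates W (mon p - mon r)" by (rule add.IH)
  moreover have "annihilates W (Var i - Var j)"
    using j(1) by (simp add: linked_def)
  ultimately have "annihilates W (mon p * (Var i - Var j) + Var j * (mon p - mon r))"
    by (intro annihilates_add annihilates_mult)
  also have "mon p * (Var i - Var j) + Var j * (mon p - mon r) = mon (Poly_Mapping.single i 1 + p) - mon q"
    unfolding q mon_add Var_eq_mon by (simp add: algebra_simps)
  finally show ?case .
qed

section \<open>Coefficients along arithmetic progressions\<close>

lemma lookup_mon_mult: "Poly_Mapping.lookup (mon p * f) (p + q) = Poly_Mapping.lookup f q"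
proof (induction f rule: poly_diff_induct)
  case (mon r)
  show ?case unfolding mon_add [symmetric] by (simp add: lookup_single when_def)
qed (simp_all add: right_diff_distrib lookup_minus)

lemma lookup_mon_mult_eq_0:
  assumes "\<And>r. q \<noteq> p + r"
  shows "Poly_Mapping.lookup (mon p * f) q = 0"
proof (induction f rule: poly_diff_induct)
  case (mon r)
  show ?case unfolding mon_add [symmetric] using assms [of r] by (simp add: lookup_single when_def)
qed (simp_all add: right_diff_distrib lookup_minus)

definition progression :: "monomial \<Rightarrow> (nat \<Rightarrow> monomial) \<Rightarrow> bool" where
  "progression a L \<longleftrightarrow> (\<forall>N. L (Suc N) = L N + a)"

lemma progression_shift: "progression a L \<Longrightarrow> progression a (\<lambda>N. L (N + k))"
  by (simp add: progression_def)

lemma weight_progression: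
  assumes "progression a L"
  shows "weight C (L N) = weight C (L 0) + N * weight C a"
  using assms by (induction N) (simp_all add: progression_def weight_add)

lemma progression_perm_mon:
  assumes "progression a L"
  shows "progression (perm_mon W a) (\<lambda>N. perm_mon W (L N))"
  using assms by (simp add: progression_def perm_mon_add)

lemma operators_eventually_polynomial:
  assumes T: "T \<in> operators d"
    and words: "\<And>W L M. num_diffs W < d \<Longrightarrow> progression a L \<Longrightarrow> progression n M \<Longrightarrow>
      eventually_polynomial (\<lambda>N. Poly_Mapping.lookup (act W (mon (L N))) (M N))"
    and "progression a L" "progression n M"
  shows "eventually_polynomial (\<lambda>N. Poly_Mapping.lookup (T (mon (L N))) (M N))"
  using T assms(3,4)
proof (induction arbitrary: L M)
  case zero
  show ?case by (simp add: eventually_polynomial_0)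
next
  case (act W)
  then show ?case by (rule words)
next
  case (diff S T)
  then show ?case by (simp add: lookup_minus eventually_polynomial_diff)
next
  case (mult_mon T p)
  show ?case
  proof (cases "\<exists>k r. M k = p + r")
    case True
    then obtain k r where kr: "M k = p + r" by blast
    \<comment> \<open>Once \<open>p\<close> divides \<open>M k\<close> it divides all later terms,
      and the quotients form the progression \<open>R\<close>. If \<open>p\<close> never divides,
      all coefficients vanish.\<close>
    define R where "R = rec_nat r (\<lambda>_ q. q + n)"
    have R: "progression n R"
      by (simp add: progression_def R_def)
    have M: "M (N + k) = p + R N" for N
      by (induction N) (use kr mult_mon.prems(2) in \<open>simp_all add: R_def progression_def add.assoc\<close>)
    have "eventually_polynomial (\<lambda>N. Poly_Mapping.lookup (T (mon (L (N + k)))) (R N))"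
      using mult_mon.IH [OF progression_shift [OF mult_mon.prems(1)] R] .
    then have "eventually_polynomial (\<lambda>N. Poly_Mapping.lookup (mon p * T (mon (L (N + k)))) (M (N + k)))"
      by (simp only: M lookup_mon_mult)
    then show ?thesis by (rule eventually_polynomial_shift)
  next
    case False
    then show ?thesis by (simp add: lookup_mon_mult_eq_0 eventually_polynomial_0)
  qed
qed

lemma act_eventually_polynomial:
  assumes "progression a L" "progression n M"
  shows "eventually_polynomial (\<lambda>N. Poly_Mapping.lookup (act W (mon (L N))) (M N))"
  using assms
proof (induction "num_diffs W" arbitrary: W L M rule: less_induct)
  case less
  note L = less.prems(1) and M = less.prems(2)
  have IH: "eventually_polynomial (\<lambda>N. Poly_Mapping.lookup (T (mon (L' N))) (M' N))"
    if "T \<in> operators (num_diffs W)" "progression a L'" "progression n M'" for T L' M'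
    using operators_eventually_polynomial [OF that(1) less.hyps that(2,3)] .
  show ?case
  proof (cases "\<forall>i. weight (linked W i) (perm_mon W a) = weight (linked W i) n")
    case True
    then have "annihilates W (mon (perm_mon W a) - mon n)"
      by (intro annihilates_mon_diff) simp
    \<comment> \<open>The sum telescopes: \<open>mon a\<close> leaves \<open>W\<close> as
      \<open>mon (perm_mon W a)\<close>, which is then exchanged for \<open>mon n\<close>.\<close>
    then have "(\<lambda>f. (act W (mon a * f) - perm_vars W (mon a) * act W f) +
        (mon (perm_mon W a) - mon n) * act W f) \<in> operators (num_diffs W)"
      unfolding annihilates_def by (intro operators_add act_mult_operators)
    then have T: "(\<lambda>f. act W (mon a * f) - mon n * act W f) \<in> operators (num_diffs W)"
      by (simp add: perm_vars_mon left_diff_distrib)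
    have steps: "mon (L (Suc N)) = mon a * mon (L N)" "M (Suc N) = n + M N" for N
      unfolding mon_add [symmetric] using L M
      by (simp_all only: progression_def add.commute [of _ a] add.commute [of _ n])
    \<comment> \<open>At the target \<open>n + M N\<close>, the factor \<open>mon n\<close> of the
      second term cancels. The lower operator therefore computes the difference of consecutive
      coefficients.\<close>
    from IH [OF T L progression_shift [OF M, of 1]]
    have "eventually_polynomial (\<lambda>N. Poly_Mapping.lookup
      (act W (mon (L (Suc N)))) (M (Suc N)) - Poly_Mapping.lookup (act W (mon (L N))) (M N))"
      unfolding Suc_eq_plus1 [symmetric] steps lookup_minus lookup_mon_mult .
    then show ?thesis by (rule eventually_polynomial_antidifference)
  next
    case False
    then obtain i where i: "weight (linked W i) (perm_mon W a) \<noteq> weight (linked W i) n" by blast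
    define C where "C = linked W i"
    obtain c where c: "\<And>p. homogeneous C (int (weight C (perm_mon W p)) + c) (act W (mon p))"
      using homogeneous_act [of W C] linked_roots unfolding C_def by metis
    \<comment> \<open>Equality of degrees, necessary for a nonzero coefficient, becomes
      \<open>N * A = B\<close>; as \<open>A\<close> is nonzero, this bounds
      \<open>N\<close>.\<close>
    define A where "A = int (weight C n) - int (weight C (perm_mon W a))"
    define B where "B = int (weight C (perm_mon W (L 0))) + c - int (weight C (M 0))"
    have A: "A \<noteq> 0"
      using i by (simp add: A_def C_def)
    have *: "int N * A = B" if "Poly_Mapping.lookup (act W (mon (L N))) (M N) \<noteq> 0" for N
    proof -
      have "M N \<in> Poly_Mapping.keys (act W (mon (L N)))"
        using that by (simp add: in_keys_iff)
      then have "int (weight C (M N)) = int (weight C (perm_mon W (L N))) + c"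
        using c [of "L N"] by (auto simp: homogeneous_def)
      then show ?thesis
        unfolding weight_progression [OF M, where N = N]
          weight_progression [OF progression_perm_mon [OF L], where N = N]
        by (simp add: A_def B_def algebra_simps)
    qed
    have "Poly_Mapping.lookup (act W (mon (L N))) (M N) = 0" if "N > nat \<bar>B\<bar>" for N
    proof (rule ccontr)
      assume "Poly_Mapping.lookup (act W (mon (L N))) (M N) \<noteq> 0"
      then have "\<bar>B\<bar> = int N * \<bar>A\<bar>"
        using * [of N] by (metis abs_mult abs_of_nat)
      moreover have "int N * \<bar>A\<bar> \<ge> int N * 1"
        using A by (intro mult_left_mono) auto
      ultimately show False using that by linarith
    qed
    then have "\<forall>\<^sub>F N in sequentially. 0 = Poly_Mapping.lookup (act W (mon (L N))) (M N)"
      unfolding eventually_sequentially by (metis Suc_le_lessD)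
    then show ?thesis
      using eventually_polynomial_0 by (rule eventually_polynomial_cong)
  qed
qed

subsection \<open>Schubert polynomials and Lehmer codes\<close>

lemma comp_adj_transp [simp]: "w \<circ> adj_transp i \<circ> adj_transp i = w"
  by (rule ext) simp

lemma adj_transp_permutes: "i \<in> {1..<m} \<Longrightarrow> adj_transp i permutes {1..m}"
  unfolding adj_transp_def by (rule permutes_swap_id) auto

lemma permutes_comp_adj_transp:
  "w permutes {1..m} \<Longrightarrow> i \<in> {1..<m} \<Longrightarrow> (w \<circ> adj_transp i) permutes {1..m}"
  by (rule permutes_compose [OF adj_transp_permutes])

text \<open>A termination measure for climbing to the longest permutation: an exchange at an ascent
  moves the larger value to the smaller index.\<close>

definition position_sum :: "nat \<Rightarrow> (nat \<Rightarrow> nat) \<Rightarrow> nat" where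
  "position_sum m w = (\<Sum>i=1..m. i * w i)"

lemma position_sum_less:
  assumes "i \<in> {1..<m}" "w i < w (Suc i)"
  shows "position_sum m (w \<circ> adj_transp i) < position_sum m w"
proof -
  define R where "R = {1..m} - {i, Suc i}"
  have S: "{1..m} = insert i (insert (Suc i) R)" and R: "i \<notin> R" "Suc i \<notin> R" "finite R"
    using assms(1) by (auto simp: R_def)
  have "(\<Sum>k\<in>R. k * (w \<circ> adj_transp i) k) = (\<Sum>k\<in>R. k * w k)"
    by (rule sum.cong) (use R in \<open>metis comp_apply adj_transp_simps(3)\<close>)+
  moreover have "i * w (Suc i) + Suc i * w i < i * w i + Suc i * w (Suc i)"
    using assms(2) by simp
  ultimately show ?thesis
    unfolding position_sum_def S using R by simp
qed

lemma longest_perm_less: "i \<in> {1..<m} \<Longrightarrow> longest_perm m (Suc i) < longest_perm m i"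
  by (auto simp: longest_perm_def)

lemma longest_perm_permutes: "longest_perm m permutes {1..m}"
proof (rule bij_imp_permutes)
  show "bij_betw (longest_perm m) {1..m} {1..m}"
    by (rule bij_betw_byWitness [where f' = "longest_perm m"]) (auto simp: longest_perm_def)
qed (auto simp: longest_perm_def)

text \<open>As \<open>w\<close> decreases strictly, \<open>w i + i\<close> decreases weakly, between
  a value at most \<open>m + 1\<close> for \<open>i = 1\<close> and one at least
  \<open>m + 1\<close> for \<open>i = m\<close>.\<close>

lemma eq_longest_perm:
  assumes w: "w permutes {1..m}" and dec: "\<And>i. i \<in> {1..<m} \<Longrightarrow> w (Suc i) < w i"
  shows "w = longest_perm m"
proof
  fix i
  show "w i = longest_perm m i"
  proof (cases "i \<in> {1..m}")
    case True
    then have im: "1 \<le> i" "i \<le> m" by auto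
    have range: "w k \<in> {1..m}" if "k \<in> {1..m}" for k
      using w that by (metis permutes_in_image)
    have "w i + i \<le> m + 1"
      using im
    proof (induction i rule: dec_induct)
      case base
      then show ?case using range [of 1] by auto
    next
      case (step n)
      then show ?case using dec [of n] by auto
    qed
    moreover have "w i + i \<ge> m + 1"
      using im(2,1)
    proof (induction i rule: inc_induct)
      case base
      then show ?case using range [of m] by auto
    next
      case (step n)
      then show ?case using dec [of n] by auto
    qed
    ultimately show ?thesis using True by (simp add: longest_perm_def)
  next
    case False
    then show ?thesis using w by (auto simp: longest_perm_def permutes_def)
  qed
qed

lemma ascent_cases:
  assumes "w permutes {1..m}"
  obtains "w = longest_perm m" | i where "i \<in> {1..<m}" "w i < w (Suc i)"
proof (cases "\<exists>i\<in>{1..<m}. w i < w (Suc i)")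
  case False
  have "w (Suc i) < w i" if "i \<in> {1..<m}" for i
  proof -
    have "w i \<noteq> w (Suc i)"
      using permutes_inj [OF assms] by (metis injD n_not_Suc_n)
    then show ?thesis using False that by (meson linorder_neqE_nat)
  qed
  then have "w = longest_perm m" by (rule eq_longest_perm [OF assms])
  then show ?thesis by (rule that(1))
qed (use that in blast)

section \<open>Existence and uniqueness of the Schubert polynomial\<close>

lemma is_schubert_ascent:
  assumes "is_schubert m (w \<circ> adj_transp i) f" "i \<in> {1..<m}" "w i < w (Suc i)"
  shows "is_schubert m w (div_diff i f)"
  using is_schubert.descent [OF assms(1,2)] assms(3) by simp

lemma is_schubert_permutes: "is_schubert m w f \<Longrightarrow> w permutes {1..m}"
proof (induction rule: is_schubert.induct)
  case longest
  show ?case by (rule longest_perm_permutes)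
next
  case (descent w f i)
  then show ?case by (intro permutes_comp_adj_transp)
qed

lemma is_schubert_cases:
  assumes "is_schubert m w f"
  obtains "w = longest_perm m" "f = (\<Prod>i=1..m. Var i ^ (m - i))"
  | i g where "i \<in> {1..<m}" "w i < w (Suc i)" "is_schubert m (w \<circ> adj_transp i) g" "f = div_diff i g"
  using assms
proof cases
  case (descent u g i)
  then show ?thesis by (intro that(2) [of i g]) auto
qed (use that(1) in auto)

lemma is_schubert_exists: "w permutes {1..m} \<Longrightarrow> \<exists>f. is_schubert m w f"
proof (induction "position_sum m w" arbitrary: w rule: less_induct)
  case less
  from less.prems show ?case
  proof (cases rule: ascent_cases)
    case (2 i)
    then show ?thesis
      using less.hyps [OF position_sum_less permutes_comp_adj_transp] less.prems is_schubert_ascent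
      by blast
  qed (use is_schubert.longest in blast)
qed

text \<open>A diamond argument. Two ascents of \<open>w\<close> lead up to a common permutation
  \<open>z\<close>; by induction both intermediate polynomials come from that of \<open>z\<close>,
  and the commutation or braid relation identifies the results.\<close>

lemma is_schubert_unique: "is_schubert m w f \<Longrightarrow> is_schubert m w g \<Longrightarrow> f = g"
proof (induction "position_sum m w" arbitrary: w f g rule: less_induct)
  case less
  have w: "w permutes {1..m}"
    using less.prems(1) by (rule is_schubert_permutes)
  have IH: "f' = g'" if "i \<in> {1..<m}" "w i < w (Suc i)"
    "is_schubert m (w \<circ> adj_transp i) f'" "is_schubert m (w \<circ> adj_transp i) g'" for i f' g'
    using less.hyps [OF position_sum_less] that by blast
  have ordered: "div_diff i f' = div_diff j g'"
    if i: "i \<in> {1..<m}" "w i < w (Suc i)" "is_schubert m (w \<circ> adj_transp i) f'"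
      and j: "j \<in> {1..<m}" "w j < w (Suc j)" "is_schubert m (w \<circ> adj_transp j) g'"
      and ij: "i < j" for i j f' g'
  proof (cases "j = Suc i")
    case False
    with ij have ij: "Suc i < j" by simp
    define z where "z = w \<circ> adj_transp i \<circ> adj_transp j"
    have z': "z = w \<circ> adj_transp j \<circ> adj_transp i"
      using ij by (auto simp: z_def adj_transp_def Transposition.transpose_def)
    obtain k where k: "is_schubert m z k"
      using is_schubert_exists permutes_comp_adj_transp w i(1) j(1) unfolding z_def by blast
    have "is_schubert m (w \<circ> adj_transp i) (div_diff j k)"
      by (rule is_schubert_ascent) (use k ij i j in \<open>auto simp: z_def\<close>)
    then have f': "f' = div_diff j k" using IH i by blast
    have "is_schubert m (w \<circ> adj_transp j) (div_diff i k)"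
      by (rule is_schubert_ascent) (use k ij i j in \<open>auto simp: z'\<close>)
    then have "g' = div_diff i k" using IH j by blast
    with f' show ?thesis using div_diff_commute [OF ij] by simp
  next
    case True
    \<comment> \<open>\<open>w\<close> increases on three consecutive positions, and
      \<open>z\<close> reverses its values there.\<close>
    define z where "z = w \<circ> adj_transp i \<circ> adj_transp j \<circ> adj_transp i"
    have z': "z = w \<circ> adj_transp j \<circ> adj_transp i \<circ> adj_transp j"
      using True by (auto simp: z_def adj_transp_braid)
    obtain k where k: "is_schubert m z k"
      using is_schubert_exists permutes_comp_adj_transp w i(1) j(1) unfolding z_def by blast
    have "is_schubert m (w \<circ> adj_transp i \<circ> adj_transp j) (div_diff i k)"
      by (rule is_schubert_ascent) (use k i j True in \<open>auto simp: z_def\<close>)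
    then have "is_schubert m (w \<circ> adj_transp i) (div_diff j (div_diff i k))"
      by (rule is_schubert_ascent) (use i j True in auto)
    then have f': "f' = div_diff j (div_diff i k)" using IH i by blast
    have "is_schubert m (w \<circ> adj_transp j \<circ> adj_transp i) (div_diff j k)"
      by (rule is_schubert_ascent) (use k i j True in \<open>auto simp: z'\<close>)
    then have "is_schubert m (w \<circ> adj_transp j) (div_diff i (div_diff j k))"
      by (rule is_schubert_ascent) (use i j True in auto)
    then have "g' = div_diff i (div_diff j k)" using IH j by blast
    with f' True show ?thesis using div_diff_braid by simp
  qed
  have not_longest: "w \<noteq> longest_perm m" if "i \<in> {1..<m}" "w i < w (Suc i)" for i
    using longest_perm_less [OF that(1)] that(2) by auto
  from less.prems(1) show ?case
  proof (cases rule: is_schubert_cases)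
    case 1
    with less.prems(2) not_longest show ?thesis
      by (cases rule: is_schubert_cases) auto
  next
    case f: (2 i f')
    from less.prems(2) show ?thesis
    proof (cases rule: is_schubert_cases)
      case 1
      with not_longest f show ?thesis by blast
    next
      case g: (2 j g')
      consider "i < j" | "j < i" | "i = j" by linarith
      then show ?thesis
      proof cases
        case 1
        with f g ordered show ?thesis by blast
      next
        case 2
        with f g ordered show ?thesis by metis
      next
        case 3
        with f g IH show ?thesis by blast
      qed
    qed
  qed
qed

lemma schubert_eq: "is_schubert m w f \<Longrightarrow> schubert m w = f"
  unfolding schubert_def using is_schubert_unique by (intro the_equality) blast+

section \<open>Lehmer codes and ascents\<close>

text \<open>After the exchange the larger value also has the smaller one to its right, whence the
  \<open>Suc\<close>. For positions before \<open>i\<close>, the counted set is only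
  permuted.\<close>

lemma lehmer_code_ascent:
  assumes i: "i \<in> {1..<m}" and less: "w i < w (Suc i)"
  shows "lehmer_code m (w \<circ> adj_transp i) =
    (lehmer_code m w)(i := Suc (lehmer_code m w (Suc i)), Suc i := lehmer_code m w i)"
proof
  fix k
  consider "k = i" | "k = Suc i" | "k < i" | "k > Suc i" by linarith
  then show "lehmer_code m (w \<circ> adj_transp i) k =
    ((lehmer_code m w)(i := Suc (lehmer_code m w (Suc i)), Suc i := lehmer_code m w i)) k"
  proof cases
    case 1
    have "{j \<in> {i<..m}. w (adj_transp i j) < w (Suc i)} =
      insert (Suc i) {j \<in> {Suc i<..m}. w j < w (Suc i)}"
      using i less by (auto simp: adj_transp_def Transposition.transpose_def split: if_splits)
    then show ?thesis using 1 by (simp add: lehmer_code_def)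
  next
    case 2
    have "Suc i < j \<and> w (adj_transp i j) < w i \<longleftrightarrow> i < j \<and> w j < w i" for j
    proof -
      consider "j \<le> i" | "j = Suc i" | "Suc i < j" by linarith
      then show ?thesis by cases (use less in auto)
    qed
    then have "{j \<in> {Suc i<..m}. w (adj_transp i j) < w i} = {j \<in> {i<..m}. w j < w i}"
      by (auto simp del: adj_transp_simps)
    then show ?thesis using 2 by (simp add: lehmer_code_def)
  next
    case 3
    have mem: "adj_transp i j \<in> {k<..m} \<longleftrightarrow> j \<in> {k<..m}" for j
      using 3 i by (auto simp: adj_transp_def Transposition.transpose_def)
    have "{j \<in> {k<..m}. w (adj_transp i j) < w k} = adj_transp i ` {j \<in> {k<..m}. w j < w k}"
    proof (intro set_eqI iffI)
      fix j assume "j \<in> {j \<in> {k<..m}. w (adj_transp i j) < w k}"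
      then have "adj_transp i j \<in> {j \<in> {k<..m}. w j < w k}"
        using mem by blast
      then show "j \<in> adj_transp i ` {j \<in> {k<..m}. w j < w k}"
        by (metis adj_transp_involutory image_eqI)
    next
      fix j assume "j \<in> adj_transp i ` {j \<in> {k<..m}. w j < w k}"
      then show "j \<in> {j \<in> {k<..m}. w (adj_transp i j) < w k}"
        using mem by fastforce
    qed
    then show ?thesis using 3
      by (simp add: lehmer_code_def card_image inj_on_subset [OF inj_adj_transp])
  next
    case 4
    have "{j \<in> {k<..m}. w (adj_transp i j) < w k} = {j \<in> {k<..m}. w j < w k}"
      using 4 by auto
    then show ?thesis using 4 by (simp add: lehmer_code_def)
  qed
qed

text \<open>Together with \<open>lehmer_code_less\<close>, this lets ascents of a permutation be
  read off its code.\<close>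

lemma lehmer_code_le:
  assumes "w i < w (Suc i)"
  shows "lehmer_code m w i \<le> lehmer_code m w (Suc i)"
  unfolding lehmer_code_def
proof (rule card_mono)
  have "Suc i < j" if "i < j" "w j < w i" for j
    using that assms by (cases "j = Suc i") auto
  then show "{j \<in> {i<..m}. w j < w i} \<subseteq> {j \<in> {Suc i<..m}. w j < w (Suc i)}"
    using assms by auto
qed simp

lemma lehmer_code_less:
  assumes "w (Suc i) < w i" "i < m"
  shows "lehmer_code m w (Suc i) < lehmer_code m w i"
proof -
  have "insert (Suc i) {j \<in> {Suc i<..m}. w j < w (Suc i)} \<subseteq> {j \<in> {i<..m}. w j < w i}"
    using assms by auto
  then have "card (insert (Suc i) {j \<in> {Suc i<..m}. w j < w (Suc i)}) \<le> card {j \<in> {i<..m}. w j < w i}"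
    by (intro card_mono) auto
  then show ?thesis by (simp add: lehmer_code_def)
qed

lemma lehmer_code_longest_perm: "i \<in> {1..m} \<Longrightarrow> lehmer_code m (longest_perm m) i = m - i"
proof -
  assume "i \<in> {1..m}"
  then have "{j \<in> {i<..m}. longest_perm m j < longest_perm m i} = {i<..m}"
    by (auto simp: longest_perm_def)
  then show ?thesis by (simp add: lehmer_code_def)
qed

section \<open>Weakly decreasing codes give monomials\<close>

lemma lookup_exponent: "Poly_Mapping.lookup (exponent h a) k = (if k \<in> {1..h} then a k else 0)"
  by (simp add: exponent_def lookup_sum lookup_single when_def)

lemma exponent_add: "exponent h (\<lambda>i. a i + b i) = exponent h a + exponent h b"
  by (rule poly_mapping_eqI) (simp add: lookup_exponent lookup_add)

lemma mon_exponent: "mon (exponent h a) = (\<Prod>i=1..h. Var i ^ a i)"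
proof -
  have pow: "mon (Poly_Mapping.single i k) = Var i ^ k" for i k
  proof (induction k)
    case (Suc k)
    have "Poly_Mapping.single i (Suc k) = Poly_Mapping.single i 1 + Poly_Mapping.single i k"
      by (simp flip: single_add)
    then show ?case using Suc by (simp only: mon_add Var_eq_mon power_Suc)
  qed simp
  have "mon (\<Sum>i\<in>A. Poly_Mapping.single i (a i)) = (\<Prod>i\<in>A. Var i ^ a i)" if "finite A" for A
    using that by induction
      (simp_all only: sum.empty prod.empty mon_0 sum.insert prod.insert mon_add pow not_False_eq_True)
  then show ?thesis by (simp add: exponent_def)
qed

text \<open>
  At the least ascent \<open>i\<close> of a permutation with weakly decreasing code, the entries
  \<open>i\<close> and \<open>i + 1\<close> of the code agree, and \<open>w \<circ> s\<^sub>i\<close> has again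
  a weakly decreasing code, with entry \<open>i\<close> increased by one.
\<close>

lemma is_schubert_dominant:
  assumes "w permutes {1..m}" "\<And>i. i \<in> {1..<m} \<Longrightarrow> lehmer_code m w (Suc i) \<le> lehmer_code m w i"
  shows "is_schubert m w (mon (exponent m (lehmer_code m w)))"
  using assms
proof (induction "position_sum m w" arbitrary: w rule: less_induct)
  case less
  show ?case
  proof (cases "\<exists>i. i \<in> {1..<m} \<and> w i < w (Suc i)")
    case False
    with ascent_cases [OF less.prems(1)] have w: "w = longest_perm m" by metis
    then have "exponent m (lehmer_code m w) = exponent m (\<lambda>i. m - i)"
      by (intro poly_mapping_eqI) (simp add: lookup_exponent lehmer_code_longest_perm)
    then show ?thesis using is_schubert.longest w by (simp add: mon_exponent)
  next
    case True
    define c where "c = lehmer_code m w"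
    define i where "i = (LEAST i. i \<in> {1..<m} \<and> w i < w (Suc i))"
    have i: "i \<in> {1..<m}" "w i < w (Suc i)"
      using LeastI_ex [OF True] by (simp_all add: i_def)
    have eq: "c (Suc i) = c i"
      using less.prems(2) [OF i(1)] lehmer_code_le [of w i m] i(2) by (simp add: c_def)
    have c': "lehmer_code m (w \<circ> adj_transp i) = c(i := Suc (c i))"
      using lehmer_code_ascent [of i m w, OF i] eq by (auto simp: c_def)
    have "is_schubert m (w \<circ> adj_transp i) (mon (exponent m (lehmer_code m (w \<circ> adj_transp i))))"
    proof (rule less.hyps)
      show "position_sum m (w \<circ> adj_transp i) < position_sum m w"
        using i by (rule position_sum_less)
      show "(w \<circ> adj_transp i) permutes {1..m}"
        using less.prems(1) i(1) by (rule permutes_comp_adj_transp)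
      fix k assume k: "k \<in> {1..<m}"
      \<comment> \<open>By leastness of \<open>i\<close> the position before it is a descent, so its
        entry is strictly larger and leaves room for the increase at \<open>i\<close>.\<close>
      have "c i < c k" if "Suc k = i"
      proof -
        have "k < i" using that by simp
        then have "\<not> w k < w (Suc k)"
          using not_less_Least k unfolding i_def by blast
        moreover have "w k \<noteq> w (Suc k)"
          using permutes_inj [OF less.prems(1)] by (metis injD n_not_Suc_n)
        ultimately show ?thesis
          using lehmer_code_less [of w k m] k that by (simp add: c_def)
      qed
      then show "lehmer_code m (w \<circ> adj_transp i) (Suc k) \<le> lehmer_code m (w \<circ> adj_transp i) k"
        unfolding c' using less.prems(2) [OF k] by (auto simp: c_def)
    qed
    \<comment> \<open>Equal entries at \<open>i\<close> and \<open>Suc i\<close> make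
      \<open>x^c\<close> invariant under the exchange, so
      \<open>\<partial>_i (x_i x^c) = x^c\<close>.\<close>
    moreover have "div_diff i (mon (exponent m (c(i := Suc (c i))))) = mon (exponent m c)"
    proof (rule div_diff_unique)
      have e: "exponent m (c(i := Suc (c i))) = Poly_Mapping.single i 1 + exponent m c"
        using i by (intro poly_mapping_eqI) (auto simp: lookup_exponent lookup_add lookup_single when_def)
      have "swap_mon i (exponent m c) = exponent m c"
      proof (rule poly_mapping_eqI)
        fix k
        show "Poly_Mapping.lookup (swap_mon i (exponent m c)) k = Poly_Mapping.lookup (exponent m c) k"
          using i eq by (cases "k = i \<or> k = Suc i") (auto simp: lookup_swap_mon lookup_exponent)
      qed
      then have "swap_vars i (mon (exponent m c)) = mon (exponent m c)"
        by (simp only: swap_vars_mon)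
      then show "mon (exponent m c) * (Var i - Var (i + 1)) =
        mon (exponent m (c(i := Suc (c i)))) - swap_vars i (mon (exponent m (c(i := Suc (c i)))))"
        unfolding e mon_add Var_eq_mon [symmetric] swap_vars_mult
        by (simp add: swap_vars_Var algebra_simps)
    qed
    ultimately show ?thesis
      using is_schubert_ascent i by (metis c' c_def)
  qed
qed

section \<open>Sorting the codes uniformly in \<open>N\<close>\<close>

text \<open>The termination measure for sorting. Its bound depends on \<open>h\<close> alone, so one
  induction serves all large \<open>N\<close>.\<close>

definition noninversions :: "nat \<Rightarrow> (nat \<Rightarrow> nat) \<Rightarrow> nat" where
  "noninversions h w = card {(a, b). 1 \<le> a \<and> a < b \<and> b \<le> h \<and> w a < w b}"

lemma finite_noninversions: "finite {(a, b). 1 \<le> a \<and> a < b \<and> b \<le> h \<and> P a b}" for h :: nat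
  by (rule finite_subset [of _ "{..h} \<times> {..h}"]) auto

lemma noninversions_le: "noninversions h w \<le> Suc h * Suc h"
proof -
  have "noninversions h w \<le> card ({..h} \<times> {..h})"
    unfolding noninversions_def by (rule card_mono) auto
  then show ?thesis by simp
qed

text \<open>The exchange maps the noninversions of the new permutation injectively to those of
  \<open>w\<close>, missing \<open>(i, Suc i)\<close>, the only pair of positions whose order it
  reverses.\<close>

lemma noninversions_less:
  assumes i: "i \<in> {1..<h}" "w i < w (Suc i)"
  shows "noninversions h (w \<circ> adj_transp i) < noninversions h w"
proof -
  let ?N = "\<lambda>w. {(a, b). 1 \<le> a \<and> a < b \<and> b \<le> h \<and> w a < w b}"
  let ?s = "map_prod (adj_transp i) (adj_transp i)"
  have "?s ` ?N (w \<circ> adj_transp i) \<subseteq> ?N w - {(i, Suc i)}"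
  proof
    fix x assume "x \<in> ?s ` ?N (w \<circ> adj_transp i)"
    then obtain a b where ab: "x = (adj_transp i a, adj_transp i b)" "1 \<le> a" "a < b" "b \<le> h"
      "w (adj_transp i a) < w (adj_transp i b)" by auto
    have ne: "\<not> (a = i \<and> b = Suc i)"
      using ab(5) i(2) by auto
    have less: "adj_transp i a < adj_transp i b"
      using ab(3) ne unfolding adj_transp_def Transposition.transpose_def
      by (simp split: if_split) linarith
    have "adj_transp i k \<in> {1..h} \<longleftrightarrow> k \<in> {1..h}" for k
      using adj_transp_permutes [OF i(1)] by (rule permutes_in_image)
    then have "adj_transp i a \<in> {1..h}" "adj_transp i b \<in> {1..h}"
      using ab(2-4) by (simp_all del: adj_transp_simps)
    moreover have "adj_transp i a \<noteq> i \<or> adj_transp i b \<noteq> Suc i"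
    proof (rule ccontr)
      assume "\<not> ?thesis"
      then have "adj_transp i (adj_transp i a) = Suc i" "adj_transp i (adj_transp i b) = i"
        by simp_all
      with ab(3) show False by simp
    qed
    ultimately show "x \<in> ?N w - {(i, Suc i)}"
      using ab(5) less unfolding ab(1) by simp
  qed
  moreover have "inj_on ?s (?N (w \<circ> adj_transp i))"
    by (rule inj_on_subset [OF map_prod_inj_on [OF inj_adj_transp inj_adj_transp]]) simp
  ultimately have "card (?N (w \<circ> adj_transp i)) \<le> card (?N w - {(i, Suc i)})"
    by (intro card_inj_on_le [of ?s] finite_Diff finite_noninversions)
  also have "\<dots> < card (?N w)"
    using i by (intro card_Diff1_less finite_noninversions) simp
  finally show ?thesis by (simp add: noninversions_def)
qed

text \<open>The slopes decide, and then the constants. Hence the sorting steps can be chosen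
  independently of large \<open>N\<close>.\<close>

lemma eventually_affine_le_or_greater:
  fixes a b c d :: int
  shows "(\<forall>\<^sub>F N in sequentially. int N * a + b \<le> int N * c + d) \<or>
    (\<forall>\<^sub>F N in sequentially. int N * c + d < int N * a + b)"
proof -
  consider "a < c" | "c < a" | "a = c" "b \<le> d" | "a = c" "d < b" by linarith
  then show ?thesis
  proof cases
    case 1
    have "int N * a + b \<le> int N * c + d" if "N \<ge> nat \<bar>b - d\<bar>" for N
    proof -
      have "int N * 1 \<le> int N * (c - a)" using 1 by (intro mult_left_mono) auto
      moreover have "int N * (c - a) = int N * c - int N * a" by (rule right_diff_distrib)
      moreover have "b - d \<le> int N" using that by linarith
      ultimately show ?thesis by linarith
    qed
    then show ?thesis unfolding eventually_sequentially by blast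
  next
    case 2
    have "int N * c + d < int N * a + b" if "N \<ge> Suc (nat \<bar>b - d\<bar>)" for N
    proof -
      have "int N * 1 \<le> int N * (a - c)" using 2 by (intro mult_left_mono) auto
      moreover have "int N * (a - c) = int N * a - int N * c" by (rule right_diff_distrib)
      moreover have "d - b < int N" using that by linarith
      ultimately show ?thesis by linarith
    qed
    then show ?thesis unfolding eventually_sequentially by blast
  next
    case 3
    then show ?thesis by (intro disjI1 always_eventually) simp
  next
    case 4
    then show ?thesis by (intro disjI2 always_eventually) simp
  qed
qed

definition affine_exponent :: "nat \<Rightarrow> (nat \<Rightarrow> nat) \<Rightarrow> (nat \<Rightarrow> int) \<Rightarrow> nat \<Rightarrow> monomial" where
  "affine_exponent h a b N = exponent h (\<lambda>i. nat (int N * int (a i) + b i))"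

text \<open>Below the threshold \<open>k\<close>, \<open>nat\<close> may cut negative entries to 0
  and spoil the constant step; hence the shift.\<close>

lemma progression_affine_exponent:
  assumes "\<And>N i. N \<ge> k \<Longrightarrow> i \<in> {1..h} \<Longrightarrow> int N * int (a i) + b i \<ge> 0"
  shows "progression (exponent h a) (\<lambda>N. affine_exponent h a b (N + k))"
  unfolding progression_def affine_exponent_def
proof
  fix N
  have step: "nat (int (Suc N + k) * int (a i) + b i) = nat (int (N + k) * int (a i) + b i) + a i"
    if "i \<in> {1..h}" for i
  proof -
    have "int (Suc N + k) * int (a i) + b i = (int (N + k) * int (a i) + b i) + int (a i)"
      by (simp add: algebra_simps)
    then show ?thesis
      using assms [of "N + k" i] that by (simp only: nat_add_distrib nat_int le_add2 of_nat_0_le_iff)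
  qed
  show "exponent h (\<lambda>i. nat (int (Suc N + k) * int (a i) + b i)) =
    exponent h (\<lambda>i. nat (int (N + k) * int (a i) + b i)) + exponent h a"
    unfolding exponent_add [symmetric]
  proof (rule poly_mapping_eqI)
    fix j
    show "Poly_Mapping.lookup (exponent h (\<lambda>i. nat (int (Suc N + k) * int (a i) + b i))) j =
      Poly_Mapping.lookup (exponent h (\<lambda>i. nat (int (N + k) * int (a i) + b i) + a i)) j"
      using step [of j] by (cases "j \<in> {1..h}") (simp_all only: lookup_exponent if_True if_False)
  qed
qed

text \<open>Sorting for all large \<open>N\<close> at once, by induction on a common bound for the
  noninversions. Nonnegativity is carried along so that \<open>nat\<close> does not truncate the
  final exponents.\<close>

lemma is_schubert_affine_family:
  fixes m :: "nat \<Rightarrow> nat" and w :: "nat \<Rightarrow> nat \<Rightarrow> nat"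
  assumes "\<forall>\<^sub>F N in sequentially. h \<le> m N \<and> w N permutes {1..m N} \<and> noninversions h (w N) \<le> n \<and>
    (\<forall>i\<in>{1..m N}. int (lehmer_code (m N) (w N) i) = (if i \<le> h then int N * int (a i) + b i else 0))"
  shows "\<exists>W a' b'. \<forall>\<^sub>F N in sequentially. (\<forall>i\<in>{1..h}. int N * int (a' i) + b' i \<ge> 0) \<and>
    is_schubert (m N) (w N) (act W (mon (affine_exponent h a' b' N)))"
  using assms
proof (induction n arbitrary: w a b rule: less_induct)
  case (less n)
  show ?case
  proof (cases "\<exists>i\<in>{1..<h}. \<forall>\<^sub>F N in sequentially.
      int N * int (a i) + b i \<le> int N * int (a (Suc i)) + b (Suc i)")
    case False
    \<comment> \<open>The first \<open>h\<close> entries are now eventually strictly decreasing and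
      only zeroes follow, so the Schubert polynomial is a monomial and the empty word
      suffices.\<close>
    then have "\<forall>\<^sub>F N in sequentially. \<forall>i\<in>{1..<h}.
        int N * int (a (Suc i)) + b (Suc i) < int N * int (a i) + b i"
      using eventually_affine_le_or_greater by (intro eventually_ball_finite) blast+
    with less.prems have "\<forall>\<^sub>F N in sequentially. (\<forall>i\<in>{1..h}. int N * int (a i) + b i \<ge> 0) \<and>
      is_schubert (m N) (w N) (act [] (mon (affine_exponent h a b N)))"
    proof eventually_elim
      case (elim N)
      define c where "c = lehmer_code (m N) (w N)"
      have c: "int (c i) = (if i \<le> h then int N * int (a i) + b i else 0)" if "i \<in> {1..m N}" for i
        using elim that by (simp add: c_def)
      have le: "int N * int (a (Suc i)) + b (Suc i) < int N * int (a i) + b i" if "i \<in> {1..<h}" for i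
        using elim that by blast
      have "is_schubert (m N) (w N) (mon (exponent (m N) c))"
        unfolding c_def
      proof (rule is_schubert_dominant)
        fix i assume i: "i \<in> {1..<m N}"
        have "int (c (Suc i)) \<le> int (c i)"
        proof (cases "i < h")
          case True
          then show ?thesis using c [of i] c [of "Suc i"] i le [of i] by simp
        next
          case False
          then show ?thesis using c [of "Suc i"] i by simp
        qed
        then show "lehmer_code (m N) (w N) (Suc i) \<le> lehmer_code (m N) (w N) i"
          by (simp add: c_def)
      qed (use elim in blast)
      moreover have "exponent (m N) c = affine_exponent h a b N"
        unfolding affine_exponent_def
      proof (rule poly_mapping_eqI)
        fix k
        show "Poly_Mapping.lookup (exponent (m N) c) k =
          Poly_Mapping.lookup (exponent h (\<lambda>i. nat (int N * int (a i) + b i))) k"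
          using c [of k] elim by (auto simp: lookup_exponent)
      qed
      moreover have "int N * int (a i) + b i \<ge> 0" if "i \<in> {1..h}" for i
        using c [of i] that elim by (metis atLeastAtMost_iff le_trans of_nat_0_le_iff)
      ultimately show ?case by simp
    qed
    then show ?thesis by blast
  next
    case True
    then obtain i where i: "i \<in> {1..<h}" and le: "\<forall>\<^sub>F N in sequentially.
      int N * int (a i) + b i \<le> int N * int (a (Suc i)) + b (Suc i)" by blast
    \<comment> \<open>The sorting rule on affine entries: the slopes are exchanged, and the added
      one goes into the constant term.\<close>
    define a' where "a' = a(i := a (Suc i), Suc i := a i)"
    define b' where "b' = b(i := b (Suc i) + 1, Suc i := b i)"
    have ascent: "\<forall>\<^sub>F N in sequentially. i \<in> {1..<m N} \<and> w N i < w N (Suc i)"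
      using less.prems le
    proof eventually_elim
      case (elim N)
      have im: "i \<in> {1..<m N}" using elim i by auto
      have c: "int (lehmer_code (m N) (w N) k) = int N * int (a k) + b k" if "k \<in> {1..h}" for k
        using elim(1) that by auto
      have "int (lehmer_code (m N) (w N) i) \<le> int (lehmer_code (m N) (w N) (Suc i))"
        using c [of i] c [of "Suc i"] elim(2) i by simp
      then have "\<not> lehmer_code (m N) (w N) (Suc i) < lehmer_code (m N) (w N) i"
        by simp
      then have "\<not> w N (Suc i) < w N i"
        using lehmer_code_less [of "w N" i "m N"] im by auto
      moreover have "w N i \<noteq> w N (Suc i)"
        using elim(1) permutes_inj [of "w N"] by (metis injD n_not_Suc_n)
      ultimately show ?case
        using im by simp
    qed
    have "\<forall>\<^sub>F N in sequentially. noninversions h (w N \<circ> adj_transp i) < n"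
      using ascent less.prems by eventually_elim (use i noninversions_less in \<open>blast intro: order_less_le_trans\<close>)
    \<comment> \<open>Some \<open>N\<close> has a noninversion count below \<open>n\<close>; thus
      \<open>n - 1\<close> is a genuine decrease.\<close>
    then have n: "n \<noteq> 0"
      using eventually_happens' [OF sequentially_bot] by fastforce
    have "\<forall>\<^sub>F N in sequentially. h \<le> m N \<and> (w N \<circ> adj_transp i) permutes {1..m N} \<and>
      noninversions h (w N \<circ> adj_transp i) \<le> n - 1 \<and>
      (\<forall>k\<in>{1..m N}. int (lehmer_code (m N) (w N \<circ> adj_transp i) k) =
        (if k \<le> h then int N * int (a' k) + b' k else 0))"
      using ascent less.prems
    proof eventually_elim
      case (elim N)
      have "noninversions h (w N \<circ> adj_transp i) < n"
        using elim noninversions_less [OF i, of "w N"] by simp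
      moreover have "int (lehmer_code (m N) (w N \<circ> adj_transp i) k) =
          (if k \<le> h then int N * int (a' k) + b' k else 0)" if "k \<in> {1..m N}" for k
      proof -
        have c: "int (lehmer_code (m N) (w N) j) = (if j \<le> h then int N * int (a j) + b j else 0)"
          if "j \<in> {1..m N}" for j
          using elim(2) that by blast
        have "lehmer_code (m N) (w N \<circ> adj_transp i) = (lehmer_code (m N) (w N))
            (i := Suc (lehmer_code (m N) (w N) (Suc i)), Suc i := lehmer_code (m N) (w N) i)"
          using elim(1) by (intro lehmer_code_ascent) auto
        moreover consider "k = i" | "k = Suc i" | "k \<noteq> i" "k \<noteq> Suc i" by blast
        ultimately show ?thesis
          using c [of i] c [of "Suc i"] c [of k] elim(1) i that
          by cases (simp_all add: a'_def b'_def)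
      qed
      ultimately show ?case
        using elim permutes_comp_adj_transp [of "w N" "m N" i] by simp
    qed
    from less.IH [OF _ this] n have "\<exists>W a'' b''. \<forall>\<^sub>F N in sequentially.
        (\<forall>i\<in>{1..h}. int N * int (a'' i) + b'' i \<ge> 0) \<and>
        is_schubert (m N) (w N \<circ> adj_transp i) (act W (mon (affine_exponent h a'' b'' N)))"
      by (metis diff_less neq0_conv zero_less_one)
    then obtain W a'' b'' where
      W: "\<forall>\<^sub>F N in sequentially. (\<forall>i\<in>{1..h}. int N * int (a'' i) + b'' i \<ge> 0) \<and>
        is_schubert (m N) (w N \<circ> adj_transp i) (act W (mon (affine_exponent h a'' b'' N)))"
      by blast
    from W ascent have "\<forall>\<^sub>F N in sequentially. (\<forall>i\<in>{1..h}. int N * int (a'' i) + b'' i \<ge> 0) \<and>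
        is_schubert (m N) (w N) (act (Diff i # W) (mon (affine_exponent h a'' b'' N)))"
    proof eventually_elim
      case (elim N)
      then have "is_schubert (m N) (w N) (div_diff i (act W (mon (affine_exponent h a'' b'' N))))"
        by (intro is_schubert_ascent) blast+
      with elim show ?case by simp
    qed
    then show ?thesis by blast
  qed
qed

theorem theorem5p3:
  fixes h :: nat
    and \<alpha> \<nu> :: "nat \<Rightarrow> nat"
    and \<beta> \<eta> :: "nat \<Rightarrow> int"
    and t :: "nat \<Rightarrow> nat"
    and w :: "nat \<Rightarrow> nat \<Rightarrow> nat"
  assumes nonneg_code: "\<forall>\<^sub>F N in sequentially. \<forall>i\<in>{1..h}. int N * int (\<alpha> i) + \<beta> i \<ge> 0"
    and nonneg_exponent: "\<forall>\<^sub>F N in sequentially. \<forall>i\<in>{1..h}. int N * int (\<nu> i) + \<eta> i \<ge> 0"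
    and same_degree: "\<forall>\<^sub>F N in sequentially.
      (\<Sum>i=1..h. int N * int (\<alpha> i) + \<beta> i) = (\<Sum>i=1..h. int N * int (\<nu> i) + \<eta> i)"
    and enough_zeroes: "\<forall>\<^sub>F N in sequentially.
      \<forall>i\<in>{1..h}. int N * int (\<alpha> i) + \<beta> i \<le> int (h + t N) - int i"
    and permutation: "\<forall>\<^sub>F N in sequentially. w N permutes {1..h + t N}"
    and code: "\<forall>\<^sub>F N in sequentially. \<forall>i\<in>{1..h + t N}.
      int (lehmer_code (h + t N) (w N) i) = (if i \<le> h then int N * int (\<alpha> i) + \<beta> i else 0)"
  shows "eventually_polynomial (\<lambda>N.
    coeff_at (schubert (h + t N) (w N)) (exponent h (\<lambda>i. nat (int N * int (\<nu> i) + \<eta> i))))"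
proof -
  have "\<forall>\<^sub>F N in sequentially. h \<le> h + t N \<and> w N permutes {1..h + t N} \<and>
    noninversions h (w N) \<le> Suc h * Suc h \<and> (\<forall>i\<in>{1..h + t N}.
      int (lehmer_code (h + t N) (w N) i) = (if i \<le> h then int N * int (\<alpha> i) + \<beta> i else 0))"
    using permutation code by eventually_elim (intro conjI le_add1 noninversions_le; assumption)
  from is_schubert_affine_family [OF this] obtain W a b where
    W: "\<forall>\<^sub>F N in sequentially. (\<forall>i\<in>{1..h}. int N * int (a i) + b i \<ge> 0) \<and>
      is_schubert (h + t N) (w N) (act W (mon (affine_exponent h a b N)))" by blast
  from W nonneg_exponent have "\<forall>\<^sub>F N in sequentially.
    (\<forall>i\<in>{1..h}. int N * int (a i) + b i \<ge> 0) \<and> (\<forall>i\<in>{1..h}. int N * int (\<nu> i) + \<eta> i \<ge> 0)"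
    by eventually_elim blast
  then obtain k where k: "\<And>N i. N \<ge> k \<Longrightarrow> i \<in> {1..h} \<Longrightarrow> int N * int (a i) + b i \<ge> 0"
    "\<And>N i. N \<ge> k \<Longrightarrow> i \<in> {1..h} \<Longrightarrow> int N * int (\<nu> i) + \<eta> i \<ge> 0"
    \<comment> \<open>From the common threshold \<open>k\<close> on, neither the exponents of the
      starting monomial nor the target exponents are truncated, so both are progressions after the
      shift.\<close>
    unfolding eventually_sequentially by blast
  have "eventually_polynomial (\<lambda>N. Poly_Mapping.lookup
      (act W (mon (affine_exponent h a b (N + k)))) (affine_exponent h \<nu> \<eta> (N + k)))"
    by (rule act_eventually_polynomial [OF progression_affine_exponent progression_affine_exponent])
      (use k in blast)+
  then have "eventually_polynomial (\<lambda>N. Poly_Mapping.lookup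
      (act W (mon (affine_exponent h a b N))) (affine_exponent h \<nu> \<eta> N))"
    by (rule eventually_polynomial_shift)
  moreover have "\<forall>\<^sub>F N in sequentially. Poly_Mapping.lookup
      (act W (mon (affine_exponent h a b N))) (affine_exponent h \<nu> \<eta> N) =
    coeff_at (schubert (h + t N) (w N)) (exponent h (\<lambda>i. nat (int N * int (\<nu> i) + \<eta> i)))"
    using W
  proof eventually_elim
    case (elim N)
    then have "schubert (h + t N) (w N) = act W (mon (affine_exponent h a b N))"
      by (intro schubert_eq) blast
    then show ?case by (simp only: coeff_at_def affine_exponent_def)
  qed
  ultimately show ?thesis by (rule eventually_polynomial_cong [rotated])
qed

end
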